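(* Work in the setting of the context. Assume there exist two measures $\nu^*$ and $\eta^*$ on $\mathcal E$ and two positive integers $k,l$ such that for every $q\in\mathcal Q$ and every $x\in E$, $$\frac1k\sum_{u=1}^k P_q^{(u)}(x,\cdot)\ \ge\ \nu^*(\cdot)\qquad\text{and}\qquad P_q^{(l)}(x,\cdot)\ \le\ \eta^*(\cdot).$$ Then there exist positive constants $\xi\in(0,1)$, $K$ and $\tilde K$, not depending on $n$, $\epsilon$, $q_0$, $q_1$ or $\mathcal Q_n$, such that for any $n\in\mathbb N^*$, any $\mathcal Q_n\subset\mathcal Q$, any $q_0\in\mathcal Q$, any $\epsilon>0$ and any $q_1\in\mathcal Q_n$ with $d_{\nu^*}(q_1,q_0)>\epsilon$, there exists a test $\psi_1(\mathcal H_n)$ satisfying $$\mathbb E_0^{(n)}[\psi_1(\mathcal H_n)]\le e^{-Kn\epsilon^2}\qquad\text{and}\qquad \sup_{q\in\mathcal Q_n:\ d_{\eta^*}(q_1,q)<\epsilon\xi}\mathbb E_q^{(n)}[1-\psi_1(\mathcal H_n)]\le e^{-\tilde Kn\epsilon^2}.$$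
   Context: Setting. $(E,\mathcal E)$ is a measurable space, $\mathbb R^+=[0,\infty)$ with Borel $\sigma$-algebra $\mathbb B^+$, and $\nu$ is a $\sigma$-finite measure on $(E\times\mathbb R^+,\mathcal E\otimes\mathbb B^+)$. A semi-Markov kernel density is a measurable nonnegative $q=q_x(y,t)$ ($x,y\in E$, $t\in\mathbb R^+$) with $\int q_x\,d\nu=1$ for all $x$; the associated semi-Markov kernel is $Q_x(dy,dt)=q_x(y,t)\,d\nu(y,t)$. $\mathcal Q$ is a given set of semi-Markov kernel densities. Under $q$, the homogeneous Markov renewal process $(J_n,S_n)_{n\ge0}$, $0\le S_0\le S_1\le\cdots$, with sojourn times $X_0=S_0$, $X_n=S_n-S_{n-1}$ ($n\ge1$), satisfies $\mathbb P(J_{n+1}\in B,X_{n+1}\le t\mid J_0,\dots,J_n,S_0,\dots,S_n)=Q_{J_n}(B\times[0,t])$ a.s. The embedded Markov chain $(J_n)$ has one-step transition kernel $P_q(x,B)=Q_x(B\times\mathbb R^+)$ and $n$-step transition kernel $P_q^{(n)}(x,B)$. Standing assumptions (for every $q\in\mathcal Q$): (A1) the chain $(J_n)$ is ergodic with stationary probability measure $\rho_q$; (A2) with $m(x)=\int_0^\infty\mathbb P(S_1-S_0>t\mid J_0=x)\,dt$, $\int_E\rho_q(dx)m(x)<\infty$; (A3) for all $n$, $x,y$, the conditional distribution function $t\mapsto\mathbb P(S_{n+1}-S_n\le t\mid J_n=x,J_{n+1}=y)$ is not the function $\mathbf 1_{\mathbb R^+}(t)$ (the conditional law is not the Dirac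 mass at $0$). The initial law of $(J_0,X_0)$ under $q$ is the stationary distribution $\widetilde\rho_q(A\times\Gamma)=\int_E\rho_q(dx)Q_x(A\times\Gamma)$. Distances. For two semi-Markov kernels with densities $q_1,q_2$ (kernels from $x$ written $Q_{x;1},Q_{x;2}$, densities $q_{x;1},q_{x;2}$), $h_\nu^2(Q_{x;1},Q_{x;2})=\frac12\int_{E\times\mathbb R^+}(\sqrt{q_{x;1}}-\sqrt{q_{x;2}})^2\,d\nu$; for a measure $\mu$ on $\mathcal E$, $d_\mu^2(q_1,q_2)=\int_E h_\nu^2(Q_{x;1},Q_{x;2})\,d\mu(x)$ (a semi-distance). Observations and tests. $\mathcal H_n=\{J_0,\dots,J_n,S_0,\dots,S_n\}$; $\mathbb P_q^{(n)}$ is the law of $\mathcal H_n$ under $q$ with expectation $\mathbb E_q^{(n)}$, and $\mathbb E_0^{(n)}=\mathbb E_{q_0}^{(n)}$. A test is a (possibly randomized) decision rule based on $\mathcal H_n$, i.e. a measurable function $\psi(\mathcal H_n)$ with values in $[0,1]$. *)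

theory Defs
  imports "HOL-Probability.Probability"
begin

abbreviation borel_nonneg :: "real measure" where
  "borel_nonneg \<equiv> restrict_space borel {0..}"

type_synonym 'a smk_density = "'a \<Rightarrow> 'a \<times> real \<Rightarrow> real"

definition semi_markov_density ::
    "'a measure \<Rightarrow> ('a \<times> real) measure \<Rightarrow> 'a smk_density \<Rightarrow> bool" where
  "semi_markov_density E \<nu> q \<longleftrightarrow>
     case_prod q \<in> borel_measurable (E \<Otimes>\<^sub>M (E \<Otimes>\<^sub>M borel_nonneg)) \<and>
     (\<forall>x\<in>space E. \<forall>z\<in>space \<nu>. 0 \<le> q x z) \<and>
     (\<forall>x\<in>space E. (\<integral>\<^sup>+ z. ennreal (q x z) \<partial>\<nu>) = 1)"

definition smk :: "('a \<times> real) measure \<Rightarrow> 'a smk_density \<Rightarrow> 'a \<Rightarrow> ('a \<times> real) measure" where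
  "smk \<nu> q x = density \<nu> (\<lambda>z. ennreal (q x z))"

definition emc_kernel ::
    "'a measure \<Rightarrow> ('a \<times> real) measure \<Rightarrow> 'a smk_density \<Rightarrow> 'a \<Rightarrow> 'a measure" where
  "emc_kernel E \<nu> q x = distr (smk \<nu> q x) E fst"

primrec emc_kernel_n ::
    "'a measure \<Rightarrow> ('a \<times> real) measure \<Rightarrow> 'a smk_density \<Rightarrow> nat \<Rightarrow> 'a \<Rightarrow> 'a measure" where
  "emc_kernel_n E \<nu> q 0 = return E"
| "emc_kernel_n E \<nu> q (Suc n) = (\<lambda>x. emc_kernel E \<nu> q x \<bind> emc_kernel_n E \<nu> q n)"

text \<open>Ergodicity is convergence of the \<open>n\<close>-step laws in total variation from every starting
  point, as usual for chains on a general state space.\<close>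

definition ergodic_emc ::
    "'a measure \<Rightarrow> ('a \<times> real) measure \<Rightarrow> 'a smk_density \<Rightarrow> 'a measure \<Rightarrow> bool" where
  "ergodic_emc E \<nu> q \<rho> \<longleftrightarrow>
     prob_space \<rho> \<and> sets \<rho> = sets E \<and>
     \<rho> \<bind> emc_kernel E \<nu> q = \<rho> \<and>
     (\<forall>x\<in>space E.
        (\<lambda>n. SUP B\<in>sets E. \<bar>measure (emc_kernel_n E \<nu> q n x) B - measure \<rho> B\<bar>) \<longlonglongrightarrow> 0)"

definition mean_sojourn ::
    "'a measure \<Rightarrow> ('a \<times> real) measure \<Rightarrow> 'a smk_density \<Rightarrow> 'a \<Rightarrow> ennreal" where
  "mean_sojourn E \<nu> q x = (\<integral>\<^sup>+ t\<in>{0..}. emeasure (smk \<nu> q x) (space E \<times> {t<..}) \<partial>lborel)"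

text \<open>\<open>\<kappa> x y\<close> is the conditional law of the sojourn time given that the chain moves from \<open>x\<close> to
  \<open>y\<close>, obtained by disintegrating the semi-Markov kernel over the embedded kernel. By
  homogeneity it does not depend on the index of the transition.\<close>

definition conditional_sojourn_law ::
    "'a measure \<Rightarrow> ('a \<times> real) measure \<Rightarrow> 'a smk_density \<Rightarrow> ('a \<Rightarrow> 'a \<Rightarrow> real measure) \<Rightarrow> bool" where
  "conditional_sojourn_law E \<nu> q \<kappa> \<longleftrightarrow>
     (\<forall>x\<in>space E. \<kappa> x \<in> E \<rightarrow>\<^sub>M prob_algebra borel_nonneg \<and>
        (\<forall>B\<in>sets E. \<forall>\<Gamma>\<in>sets borel_nonneg.
           emeasure (smk \<nu> q x) (B \<times> \<Gamma>) = (\<integral>\<^sup>+ y\<in>B. emeasure (\<kappa> x y) \<Gamma> \<partial>(emc_kernel E \<nu> q x))))"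

text \<open>Such a law is determined by the kernel only up to null sets of \<open>y\<close>, so the condition on all
  \<open>x, y\<close> is imposed on some version. It compares distribution functions on \<open>[0,\<infinity>)\<close>; they vanish
  on the negative half-line.\<close>

definition nondegenerate_sojourn ::
    "'a measure \<Rightarrow> ('a \<times> real) measure \<Rightarrow> 'a smk_density \<Rightarrow> bool" where
  "nondegenerate_sojourn E \<nu> q \<longleftrightarrow>
     (\<exists>\<kappa>. conditional_sojourn_law E \<nu> q \<kappa> \<and>
        (\<forall>x\<in>space E. \<forall>y\<in>space E. \<not> (\<forall>t\<ge>0. measure (\<kappa> x y) {0..t} = 1)))"

definition sojourn :: "(nat \<Rightarrow> 'w \<Rightarrow> real) \<Rightarrow> nat \<Rightarrow> 'w \<Rightarrow> real" where
  "sojourn S n \<omega> = (if n = 0 then S 0 \<omega> else S n \<omega> - S (n - 1) \<omega>)"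

definition history_space :: "'a measure \<Rightarrow> nat \<Rightarrow> (nat \<Rightarrow> 'a \<times> real) measure" where
  "history_space E n = PiM {..n} (\<lambda>_. E \<Otimes>\<^sub>M borel_nonneg)"

definition history ::
    "(nat \<Rightarrow> 'w \<Rightarrow> 'a) \<Rightarrow> (nat \<Rightarrow> 'w \<Rightarrow> real) \<Rightarrow> nat \<Rightarrow> 'w \<Rightarrow> (nat \<Rightarrow> 'a \<times> real)" where
  "history J S n \<omega> = (\<lambda>i\<in>{..n}. (J i \<omega>, S i \<omega>))"

definition history_algebra ::
    "'a measure \<Rightarrow> 'w measure \<Rightarrow> (nat \<Rightarrow> 'w \<Rightarrow> 'a) \<Rightarrow> (nat \<Rightarrow> 'w \<Rightarrow> real) \<Rightarrow> nat \<Rightarrow> 'w measure" where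
  "history_algebra E M J S n = vimage_algebra (space M) (history J S n) (history_space E n)"

definition history_law ::
    "'a measure \<Rightarrow> 'w measure \<Rightarrow> (nat \<Rightarrow> 'w \<Rightarrow> 'a) \<Rightarrow> (nat \<Rightarrow> 'w \<Rightarrow> real) \<Rightarrow> nat
      \<Rightarrow> (nat \<Rightarrow> 'a \<times> real) measure" where
  "history_law E M J S n = distr M (history_space E n) (history J S n)"

definition markov_renewal_process ::
    "'a measure \<Rightarrow> ('a \<times> real) measure \<Rightarrow> 'a smk_density \<Rightarrow> 'w measure
      \<Rightarrow> (nat \<Rightarrow> 'w \<Rightarrow> 'a) \<Rightarrow> (nat \<Rightarrow> 'w \<Rightarrow> real) \<Rightarrow> bool" where
  "markov_renewal_process E \<nu> q M J S \<longleftrightarrow>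
     prob_space M \<and>
     (\<forall>n. J n \<in> M \<rightarrow>\<^sub>M E) \<and> (\<forall>n. S n \<in> M \<rightarrow>\<^sub>M borel_nonneg) \<and>
     (\<forall>\<omega>\<in>space M. \<forall>n. S n \<omega> \<le> S (Suc n) \<omega>) \<and>
     (\<forall>n. \<forall>B\<in>sets E. \<forall>t\<ge>0. AE \<omega> in M.
        real_cond_exp M (history_algebra E M J S n)
          (indicator {\<omega>\<in>space M. J (Suc n) \<omega> \<in> B \<and> sojourn S (Suc n) \<omega> \<le> t}) \<omega>
        = measure (smk \<nu> q (J n \<omega>)) (B \<times> {0..t}))"

text \<open>A statistical model: one measurable space \<open>\<Omega>\<close> carrying the observed process \<open>(J, S)\<close>, with a
  probability measure \<open>P q\<close> on it for every density \<open>q\<close> in the parameter set.\<close>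

locale semi_markov_model =
  fixes E :: "'a measure"
    and \<nu> :: "('a \<times> real) measure"
    and \<Q> :: "'a smk_density set"
    and \<rho> :: "'a smk_density \<Rightarrow> 'a measure"
    and \<Omega> :: "'w measure"
    and P :: "'a smk_density \<Rightarrow> 'w measure"
    and J :: "nat \<Rightarrow> 'w \<Rightarrow> 'a"
    and S :: "nat \<Rightarrow> 'w \<Rightarrow> real"
  assumes sets_nu: "sets \<nu> = sets (E \<Otimes>\<^sub>M borel_nonneg)"
    and sigma_finite_nu: "sigma_finite_measure \<nu>"
    and density: "q \<in> \<Q> \<Longrightarrow> semi_markov_density E \<nu> q"
    and ergodic: "q \<in> \<Q> \<Longrightarrow> ergodic_emc E \<nu> q (\<rho> q)"
    and finite_mean_sojourn: "q \<in> \<Q> \<Longrightarrow> (\<integral>\<^sup>+ x. mean_sojourn E \<nu> q x \<partial>\<rho> q) < \<infinity>"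
    and nondegenerate: "q \<in> \<Q> \<Longrightarrow> nondegenerate_sojourn E \<nu> q"
    and sets_P: "q \<in> \<Q> \<Longrightarrow> sets (P q) = sets \<Omega>"
    and process: "q \<in> \<Q> \<Longrightarrow> markov_renewal_process E \<nu> q (P q) J S"
    and initial_law: "q \<in> \<Q> \<Longrightarrow>
      distr (P q) (E \<Otimes>\<^sub>M borel_nonneg) (\<lambda>\<omega>. (J 0 \<omega>, sojourn S 0 \<omega>)) = \<rho> q \<bind> smk \<nu> q"

definition hellinger_sq ::
    "('a \<times> real) measure \<Rightarrow> 'a smk_density \<Rightarrow> 'a smk_density \<Rightarrow> 'a \<Rightarrow> ennreal" where
  "hellinger_sq \<nu> q1 q2 x = (1 / 2) * (\<integral>\<^sup>+ z. ennreal ((sqrt (q1 x z) - sqrt (q2 x z))\<^sup>2) \<partial>\<nu>)"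

definition ennsqrt :: "ennreal \<Rightarrow> ennreal" where
  "ennsqrt a = (if a = \<infinity> then \<infinity> else ennreal (sqrt (enn2real a)))"

text \<open>The value \<open>\<infinity>\<close> is possible, since \<open>\<mu>\<close> need not be finite.\<close>

definition smk_dist ::
    "('a \<times> real) measure \<Rightarrow> 'a measure \<Rightarrow> 'a smk_density \<Rightarrow> 'a smk_density \<Rightarrow> ennreal" where
  "smk_dist \<nu> \<mu> q1 q2 = ennsqrt (\<integral>\<^sup>+ x. hellinger_sq \<nu> q1 q2 x \<partial>\<mu>)"

definition is_test :: "'a measure \<Rightarrow> nat \<Rightarrow> ((nat \<Rightarrow> 'a \<times> real) \<Rightarrow> real) \<Rightarrow> bool" where
  "is_test E n \<psi> \<longleftrightarrow>
     \<psi> \<in> borel_measurable (history_space E n) \<and> (\<forall>h\<in>space (history_space E n). 0 \<le> \<psi> h \<and> \<psi> h \<le> 1)"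

end

theory Submission
  imports Defs
begin

text \<open>For densities \<open>a, b\<close> put \<open>G(a, b) = (2\<surd>a + \<surd>b) / (\<surd>a + 2\<surd>b)\<close>, a likelihood-ratio surrogate with values
  in \<open>[1/2, 2]\<close> and \<open>G(a, b) G(b, a) = 1\<close>. For any density \<open>p\<close> one has, with \<open>h\<close> the Hellinger distance,
  \<open>\<integral> p G(a, b) + h\<^sup>2(a, b) / 6 \<le> 1 + 8 h\<^sup>2(p, b)\<close>: the expected factor is below \<open>1\<close> by \<open>h\<^sup>2(a, b) / 6\<close>, up to
  an excess due to \<open>p\<close> not being exactly \<open>b\<close>. The test rejects when a product of factors
  \<open>G(q1, q0)\<close> along the observed transitions is at least \<open>1\<close>; Markov's inequality bounds the first error by the
  expectation of this product under \<open>q0\<close> and the second one by that of its inverse, a product of factors \<open>G(q0, q1)\<close>,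
  under \<open>q\<close>. Both expectations are iterates of a tilted transition operator. Since the
  factors are bounded above and below, the iterates over a block of \<open>k + 1\<close> tilted transitions
  are compared with those of the untilted chain, so that the minorisation turns
  the local gains into \<open>d\<^sup>2\<close> at \<open>\<nu>*\<close> and, after \<open>l\<close> untilted transitions, the majorisation
  turns the local excesses into \<open>d\<^sup>2\<close> at \<open>\<eta>*\<close>. Every block thus contributes a factor
  \<open>exp(-\<delta>\<epsilon>\<^sup>2)\<close>.\<close>

section \<open>The Hellinger weight\<close>

text \<open>At \<open>a = b = 0\<close> the quotient would be \<open>0 / 0 = 0\<close>. The value
  \<open>1\<close> there keeps the weight between \<open>1/2\<close> and \<open>2\<close> and makes
  the two orders of the arguments reciprocal without exception.\<close>

definition hellinger_weight :: "real \<Rightarrow> real \<Rightarrow> real" where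
  "hellinger_weight a b =
     (if a = 0 \<and> b = 0 then 1 else (2 * sqrt a + sqrt b) / (sqrt a + 2 * sqrt b))"

lemma hellinger_weight_measurable [measurable]:
  assumes [measurable]: "f \<in> borel_measurable M" "g \<in> borel_measurable M"
  shows "(\<lambda>x. hellinger_weight (f x) (g x)) \<in> borel_measurable M"
  unfolding hellinger_weight_def by measurable

lemma hellinger_weight_bounds:
  assumes "0 \<le> a" "0 \<le> b"
  shows "1 / 2 \<le> hellinger_weight a b" "hellinger_weight a b \<le> 2"
proof -
  have "1 / 2 \<le> hellinger_weight a b \<and> hellinger_weight a b \<le> 2"
  proof (cases "a = 0 \<and> b = 0")
    case False
    then have "0 < sqrt a + 2 * sqrt b"
      using assms by (cases "a = 0") (auto intro: add_pos_nonneg)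
    then show ?thesis
      using assms False unfolding hellinger_weight_def by (auto simp: field_simps)
  qed (simp add: hellinger_weight_def)
  then show "1 / 2 \<le> hellinger_weight a b" "hellinger_weight a b \<le> 2" by auto
qed

lemma hellinger_weight_mult_swap:
  assumes "0 \<le> a" "0 \<le> b"
  shows "hellinger_weight a b * hellinger_weight b a = 1"
proof (cases "a = 0 \<and> b = 0")
  case False
  then have "0 < sqrt a + sqrt b"
    using assms by (cases "a = 0") (auto intro: add_pos_nonneg)
  then have "0 < sqrt a + 2 * sqrt b" "0 < sqrt b + 2 * sqrt a"
    using assms real_sqrt_ge_zero[of a] real_sqrt_ge_zero[of b] by linarith+
  moreover have "hellinger_weight a b = (sqrt b + 2 * sqrt a) / (sqrt a + 2 * sqrt b)"
    "hellinger_weight b a = (sqrt a + 2 * sqrt b) / (sqrt b + 2 * sqrt a)"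
    using False by (auto simp: hellinger_weight_def add.commute)
  ultimately show ?thesis by simp
qed (simp add: hellinger_weight_def)

text \<open>With \<open>s\<close>, \<open>u\<close>, \<open>v\<close> the square roots of
  \<open>p\<close>, \<open>a\<close>, \<open>b\<close>, the weight is \<open>1 + r\<close> for
  \<open>r = (u - v) / (u + 2 * v)\<close>. Expanding \<open>s\<^sup>2\<close> around
  \<open>v\<close> separates the gain already present at \<open>p = b\<close> from terms in
  \<open>s - v\<close>, which are absorbed by \<open>(s - v)\<^sup>2\<close>. The terms
  \<open>a / 6\<close> and \<open>b / 6\<close> have equal integrals when \<open>a\<close> and
  \<open>b\<close> are probability densities, so they cancel after integration.\<close>

lemma hellinger_weight_pointwise:
  assumes "0 \<le> a" "0 \<le> b" "0 \<le> p"
  shows "p * hellinger_weight a b + (sqrt a - sqrt b)\<^sup>2 / 12 + b / 6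
    \<le> p + a / 6 + 4 * (sqrt p - sqrt b)\<^sup>2"
proof (cases "a = 0 \<and> b = 0")
  case False
  define s u v where "s = sqrt p" and "u = sqrt a" and "v = sqrt b"
  have sq: "p = s\<^sup>2" "a = u\<^sup>2" "b = v\<^sup>2"
    using assms by (auto simp: s_def u_def v_def)
  have nn: "0 \<le> s" "0 \<le> u" "0 \<le> v"
    using assms by (auto simp: s_def u_def v_def)
  have pos: "0 < u + 2 * v"
    using False nn sq by (cases "u = 0") (auto intro: add_pos_nonneg)
  define r where "r = (u - v) / (u + 2 * v)"
  have G: "hellinger_weight a b = 1 + r"
  proof -
    have "(u + 2 * v) / (u + 2 * v) = 1" using pos by simp
    then have "1 + r = ((u + 2 * v) + (u - v)) / (u + 2 * v)"
      by (simp only: add_divide_distrib[of "u + 2 * v" "u - v"] r_def)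
    then show ?thesis
      using False by (simp add: hellinger_weight_def u_def v_def)
  qed
  have r_le: "r \<le> 1" using pos nn by (simp add: r_def field_simps)
  \<comment> \<open>Since \<open>1 - r = 3 * v / (u + 2 * v)\<close>, the left side is
    \<open>v * (u - v) / 3\<close> times \<open>1 - r\<close>, and the part coming from
    \<open>- r\<close> has a fixed sign.\<close>
  have v2r: "v\<^sup>2 * r \<le> (u * v - v\<^sup>2) / 3"
  proof -
    have "v\<^sup>2 * r = v * (u - v) / 3 - v * (u - v)\<^sup>2 / (3 * (u + 2 * v))"
      using pos unfolding r_def by (simp add: field_simps power2_eq_square)
    moreover have "0 \<le> v * (u - v)\<^sup>2 / (3 * (u + 2 * v))"
      using pos nn by simp
    ultimately have "v\<^sup>2 * r \<le> v * (u - v) / 3" by linarith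
    then show ?thesis by (simp add: power2_eq_square algebra_simps)
  qed
  \<comment> \<open>The factor \<open>2 * v / (u + 2 * v)\<close> is at most \<open>1\<close>, which
    leaves a product of absolute values; this is split by
    \<open>(6 * x - y)\<^sup>2 \<ge> 0\<close>.\<close>
  have cross: "2 * v * r * (s - v) \<le> 3 * (s - v)\<^sup>2 + (u - v)\<^sup>2 / 12"
  proof -
    have "\<bar>2 * v * r\<bar> = (2 * v / (u + 2 * v)) * \<bar>u - v\<bar>"
      using pos nn by (simp add: r_def abs_mult)
    also have "\<dots> \<le> 1 * \<bar>u - v\<bar>"
      using pos nn by (intro mult_right_mono) (auto simp: field_simps)
    finally have "\<bar>2 * v * r\<bar> \<le> \<bar>u - v\<bar>" by simp
    then have "\<bar>2 * v * r\<bar> * \<bar>s - v\<bar> \<le> \<bar>u - v\<bar> * \<bar>s - v\<bar>"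
      by (rule mult_right_mono) simp
    then have "2 * v * r * (s - v) \<le> \<bar>u - v\<bar> * \<bar>s - v\<bar>"
      by (metis abs_ge_self abs_mult order_trans)
    also have "\<dots> \<le> 3 * \<bar>s - v\<bar>\<^sup>2 + \<bar>u - v\<bar>\<^sup>2 / 12"
    proof -
      have "y * x \<le> 3 * x\<^sup>2 + y\<^sup>2 / 12" for x y :: real
        using zero_le_power2[of "6 * x - y"] by (simp add: power2_eq_square algebra_simps)
      then show ?thesis .
    qed
    finally show ?thesis by simp
  qed
  have "(s - v)\<^sup>2 * r \<le> (s - v)\<^sup>2"
    using r_le by (simp add: mult_left_le)
  moreover have "s\<^sup>2 * r = v\<^sup>2 * r + 2 * v * r * (s - v) + (s - v)\<^sup>2 * r"
    by (simp add: power2_eq_square algebra_simps)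
  ultimately have "s\<^sup>2 * r \<le> (u * v - v\<^sup>2) / 3 + (u - v)\<^sup>2 / 12 + 4 * (s - v)\<^sup>2"
    using v2r cross by linarith
  \<comment> \<open>Polarisation of \<open>u * v\<close> exposes the gain
    \<open>(u - v)\<^sup>2 / 6\<close>. The cross term has spent half of it, so
    \<open>1 / 12\<close> survives.\<close>
  moreover have "(u * v - v\<^sup>2) / 3 = u\<^sup>2 / 6 - v\<^sup>2 / 6 - (u - v)\<^sup>2 / 6"
    by (simp add: power2_eq_square field_simps)
  ultimately have "s\<^sup>2 * (1 + r) + (u - v)\<^sup>2 / 12 + v\<^sup>2 / 6 \<le> s\<^sup>2 + u\<^sup>2 / 6 + 4 * (s - v)\<^sup>2"
    by (simp add: algebra_simps)
  then show ?thesis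
    by (simp only: sq[symmetric]) (simp only: G s_def u_def v_def)
qed (use assms in \<open>simp add: hellinger_weight_def\<close>)

section \<open>Hellinger distances with values in \<open>ennreal\<close>\<close>

lemma hellinger_sq_commute: "hellinger_sq \<nu> p q x = hellinger_sq \<nu> q p x"
  unfolding hellinger_sq_def by (simp add: power2_commute)

lemma hellinger_sq_self: "hellinger_sq \<nu> q q x = 0"
  by (simp add: hellinger_sq_def)

lemma smk_dist_commute: "smk_dist \<nu> \<mu> p q = smk_dist \<nu> \<mu> q p"
proof -
  have "hellinger_sq \<nu> p q = hellinger_sq \<nu> q p"
    by (rule ext) (rule hellinger_sq_commute)
  then show ?thesis by (simp only: smk_dist_def)
qed

lemma smk_dist_self: "smk_dist \<nu> \<mu> q q = 0"
  by (simp add: smk_dist_def hellinger_sq_self ennsqrt_def)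

lemma ennreal_less_ennsqrt:
  assumes "0 \<le> r" "ennreal r < ennsqrt a"
  shows "ennreal (r\<^sup>2) \<le> a"
proof (cases a)
  case (real s)
  then have "r < sqrt s" using assms by (simp add: ennsqrt_def ennreal_less_iff)
  then have "r\<^sup>2 \<le> s" using assms real by (simp add: real_less_rsqrt less_imp_le sqrt_ge_absD abs_of_nonneg)
  then show ?thesis using real by (simp add: ennreal_leI)
qed simp

lemma ennsqrt_less_ennreal:
  assumes "0 \<le> r" "ennsqrt a < ennreal r"
  shows "a \<le> ennreal (r\<^sup>2)"
proof (cases a)
  case (real s)
  then have "sqrt s < r" using assms by (simp add: ennsqrt_def ennreal_less_iff)
  then have "s \<le> r\<^sup>2" using assms real by (meson less_imp_le real_sqrt_le_iff real_le_lsqrt sqrt_le_D)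
  then show ?thesis using real by (simp add: ennreal_leI)
next
  case top
  then show ?thesis using assms by (simp add: ennsqrt_def)
qed

text \<open>This is \<open>1 + x \<le> exp x\<close> at \<open>x = t - s\<close>. Gain and excess
  stand on opposite sides of the hypothesis because subtraction truncates in \<open>ennreal\<close>;
  an infinite \<open>A\<close> contradicts the finite right side.\<close>

lemma ennreal_add_le_imp_le_exp:
  assumes "A + ennreal s \<le> 1 + ennreal t" "0 \<le> s" "0 \<le> t"
  shows "A \<le> ennreal (exp (t - s))"
proof (cases A)
  case (real a)
  then have "ennreal (a + s) \<le> ennreal (1 + t)"
    using assms by (simp add: ennreal_plus)
  then have "a + s \<le> 1 + t" using assms by (subst (asm) ennreal_le_iff) auto
  then have "a \<le> 1 + (t - s)" by simp
  also have "\<dots> \<le> exp (t - s)" by (rule exp_ge_add_one_self)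
  finally show ?thesis using real by (simp add: ennreal_leI)
next
  case top
  then show ?thesis using assms by (simp add: top_unique ennreal_add_eq_top)
qed

section \<open>Tilted transition operators\<close>

text \<open>A Feynman-Kac operator for one transition: the next state enters through
  \<open>F\<close>, the whole transition through the weight. Composed by \<open>foldr\<close>, the
  head of the list weights the first transition. Values in \<open>ennreal\<close> avoid all
  integrability conditions.\<close>

definition tilt ::
    "('a \<times> real) measure \<Rightarrow> 'a smk_density \<Rightarrow> ('a \<Rightarrow> 'a \<times> real \<Rightarrow> ennreal) \<Rightarrow> ('a \<Rightarrow> ennreal)
      \<Rightarrow> 'a \<Rightarrow> ennreal" where
  "tilt \<nu> q w F x = (\<integral>\<^sup>+ z. ennreal (q x z) * (w x z * F (fst z)) \<partial>\<nu>)"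

abbreviation untilted :: "'a \<Rightarrow> 'a \<times> real \<Rightarrow> ennreal" where
  "untilted \<equiv> \<lambda>_ _. 1"

locale smk_space = sigma_finite_measure \<nu> for \<nu> :: "('a \<times> real) measure" +
  fixes E :: "'a measure"
  assumes sets_nu [measurable_cong]: "sets \<nu> = sets (E \<Otimes>\<^sub>M borel_nonneg)"
begin

lemma space_nu: "space \<nu> = space E \<times> {0..}"
  using sets_eq_imp_space_eq[OF sets_nu] by (simp add: space_pair_measure space_restrict_space)

lemma sets_pair_nu [measurable_cong]: "sets (E \<Otimes>\<^sub>M \<nu>) = sets (E \<Otimes>\<^sub>M (E \<Otimes>\<^sub>M borel_nonneg))"
  by (intro sets_pair_measure_cong sets_nu refl)

lemma density_measurable:
  "semi_markov_density E \<nu> q \<Longrightarrow> case_prod q \<in> borel_measurable (E \<Otimes>\<^sub>M \<nu>)"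
  by (simp add: semi_markov_density_def cong: measurable_cong_sets[OF sets_pair_nu])

lemma density_nonneg:
  "semi_markov_density E \<nu> q \<Longrightarrow> x \<in> space E \<Longrightarrow> z \<in> space \<nu> \<Longrightarrow> 0 \<le> q x z"
  by (simp add: semi_markov_density_def)

lemma density_nn_integral:
  "semi_markov_density E \<nu> q \<Longrightarrow> x \<in> space E \<Longrightarrow> (\<integral>\<^sup>+ z. ennreal (q x z) \<partial>\<nu>) = 1"
  by (simp add: semi_markov_density_def)

lemma section_measurable:
  "case_prod f \<in> borel_measurable (E \<Otimes>\<^sub>M \<nu>) \<Longrightarrow> x \<in> space E \<Longrightarrow> f x \<in> borel_measurable \<nu>"
  using measurable_Pair2[of "case_prod f" E \<nu> borel x] by simp

lemma density_section_measurable: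
  "semi_markov_density E \<nu> q \<Longrightarrow> x \<in> space E \<Longrightarrow> q x \<in> borel_measurable \<nu>"
  by (intro section_measurable density_measurable)

lemma fst_measurable_nu [measurable]: "fst \<in> \<nu> \<rightarrow>\<^sub>M E"
  by measurable

section \<open>Measurability, monotonicity and linearity of tilted operators\<close>

lemma tilt_measurable:
  assumes "semi_markov_density E \<nu> q"
    and w [measurable]: "case_prod w \<in> borel_measurable (E \<Otimes>\<^sub>M \<nu>)"
    and F [measurable]: "F \<in> borel_measurable E"
  shows "tilt \<nu> q w F \<in> borel_measurable E"
proof -
  have [measurable]: "case_prod q \<in> borel_measurable (E \<Otimes>\<^sub>M \<nu>)"
    by (rule density_measurable) fact
  have "(\<lambda>x. \<integral>\<^sup>+ z. ennreal (q x z) * (w x z * F (fst z)) \<partial>\<nu>) \<in> borel_measurable E"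
    by measurable
  then show ?thesis by (simp add: tilt_def[abs_def])
qed

lemma tilts_measurable:
  assumes "semi_markov_density E \<nu> q"
    and "\<And>w. w \<in> set ws \<Longrightarrow> case_prod w \<in> borel_measurable (E \<Otimes>\<^sub>M \<nu>)"
    and "F \<in> borel_measurable E"
  shows "foldr (tilt \<nu> q) ws F \<in> borel_measurable E"
  using assms(2) by (induction ws) (auto simp: assms intro!: tilt_measurable)

lemma tilt_mono:
  assumes "\<And>y. y \<in> space E \<Longrightarrow> F y \<le> G y"
  shows "tilt \<nu> q w F x \<le> tilt \<nu> q w G x"
  unfolding tilt_def
  by (intro nn_integral_mono mult_left_mono assms) (auto simp: space_nu)

lemma tilts_mono:
  assumes "\<And>y. y \<in> space E \<Longrightarrow> F y \<le> G y" "x \<in> space E"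
  shows "foldr (tilt \<nu> q) ws F x \<le> foldr (tilt \<nu> q) ws G x"
  using assms(2) by (induction ws arbitrary: x) (auto simp: assms(1) intro!: tilt_mono)

lemma tilt_cmult:
  assumes "semi_markov_density E \<nu> q" "case_prod w \<in> borel_measurable (E \<Otimes>\<^sub>M \<nu>)"
    and [measurable]: "F \<in> borel_measurable E" and x: "x \<in> space E"
  shows "tilt \<nu> q w (\<lambda>y. c * F y) x = c * tilt \<nu> q w F x"
proof -
  note [measurable] = density_section_measurable[OF assms(1) x] section_measurable[OF assms(2) x]
  show ?thesis
    unfolding tilt_def by (subst nn_integral_cmult[symmetric]) (auto simp: mult_ac)
qed

lemma tilt_add:
  assumes "semi_markov_density E \<nu> q" "case_prod w \<in> borel_measurable (E \<Otimes>\<^sub>M \<nu>)"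
    and [measurable]: "F \<in> borel_measurable E" "G \<in> borel_measurable E" and x: "x \<in> space E"
  shows "tilt \<nu> q w (\<lambda>y. F y + G y) x = tilt \<nu> q w F x + tilt \<nu> q w G x"
proof -
  note [measurable] = density_section_measurable[OF assms(1) x] section_measurable[OF assms(2) x]
  show ?thesis
    unfolding tilt_def by (subst nn_integral_add[symmetric]) (auto simp: distrib_left)
qed

context
  fixes q :: "'a smk_density" and ws :: "('a \<Rightarrow> 'a \<times> real \<Rightarrow> ennreal) list"
  assumes dens: "semi_markov_density E \<nu> q"
    and ws: "\<And>w. w \<in> set ws \<Longrightarrow> case_prod w \<in> borel_measurable (E \<Otimes>\<^sub>M \<nu>)"
begin

lemma tilts_cmult:
  assumes F: "F \<in> borel_measurable E" and x: "x \<in> space E"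
  shows "foldr (tilt \<nu> q) ws (\<lambda>y. c * F y) x = c * foldr (tilt \<nu> q) ws F x"
  using ws x
proof (induction ws arbitrary: x)
  case (Cons w ws)
  have "tilt \<nu> q w (foldr (tilt \<nu> q) ws (\<lambda>y. c * F y)) x
      = tilt \<nu> q w (\<lambda>y. c * foldr (tilt \<nu> q) ws F y) x"
    using Cons by (intro antisym tilt_mono) auto
  also have "\<dots> = c * tilt \<nu> q w (foldr (tilt \<nu> q) ws F) x"
    using Cons.prems by (intro tilt_cmult dens tilts_measurable F) auto
  finally show ?case by simp
qed simp

lemma tilts_add:
  assumes F: "F \<in> borel_measurable E" and G: "G \<in> borel_measurable E" and x: "x \<in> space E"
  shows "foldr (tilt \<nu> q) ws (\<lambda>y. F y + G y) x = foldr (tilt \<nu> q) ws F x + foldr (tilt \<nu> q) ws G x"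
  using ws x
proof (induction ws arbitrary: x)
  case (Cons w ws)
  have "tilt \<nu> q w (foldr (tilt \<nu> q) ws (\<lambda>y. F y + G y)) x
      = tilt \<nu> q w (\<lambda>y. foldr (tilt \<nu> q) ws F y + foldr (tilt \<nu> q) ws G y) x"
    using Cons by (intro antisym tilt_mono) auto
  also have "\<dots> = tilt \<nu> q w (foldr (tilt \<nu> q) ws F) x + tilt \<nu> q w (foldr (tilt \<nu> q) ws G) x"
    using Cons.prems by (intro tilt_add dens tilts_measurable F G) auto
  finally show ?case by simp
qed simp

lemma tilts_sum:
  assumes F: "\<And>i. F i \<in> borel_measurable E" and x: "x \<in> space E" and "finite A"
  shows "foldr (tilt \<nu> q) ws (\<lambda>y. \<Sum>i\<in>A. F i y) x = (\<Sum>i\<in>A. foldr (tilt \<nu> q) ws (F i) x)"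
  using \<open>finite A\<close>
proof (induction A)
  case empty
  then show ?case using tilts_cmult[of "\<lambda>_. 0" x 0] x by simp
next
  case (insert i A)
  then show ?case using tilts_add[of "F i" "\<lambda>y. \<Sum>i\<in>A. F i y" x] F x by simp
qed

text \<open>This plays the role of the Markov property: a bound on the later factors that is uniform
  in the state where they start can be pulled out of the earlier ones.\<close>

lemma tilts_le_const:
  assumes "\<And>y. y \<in> space E \<Longrightarrow> F y \<le> c" and x: "x \<in> space E"
  shows "foldr (tilt \<nu> q) ws F x \<le> c * foldr (tilt \<nu> q) ws (\<lambda>_. 1) x"
proof -
  have "foldr (tilt \<nu> q) ws F x \<le> foldr (tilt \<nu> q) ws (\<lambda>_. c * 1) x"
    using assms by (intro tilts_mono) auto
  then show ?thesis using tilts_cmult[of "\<lambda>_. 1" x c] x by simp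
qed

end

text \<open>The constant \<open>c\<close> is paid once per transition. With \<open>c = 2\<close> it
  compares tilted and untilted iterates in both directions, the weights lying between
  \<open>1/2\<close> and \<open>2\<close>.\<close>

lemma tilt_le_scaled:
  assumes dens: "semi_markov_density E \<nu> q"
    and w: "case_prod w \<in> borel_measurable (E \<Otimes>\<^sub>M \<nu>)" "case_prod w' \<in> borel_measurable (E \<Otimes>\<^sub>M \<nu>)"
    and le: "\<And>x z. x \<in> space E \<Longrightarrow> z \<in> space \<nu> \<Longrightarrow> w x z \<le> c * w' x z"
    and F: "F \<in> borel_measurable E" and x: "x \<in> space E"
  shows "(tilt \<nu> q w ^^ u) F x \<le> c ^ u * (tilt \<nu> q w' ^^ u) F x"
  using x
proof (induction u arbitrary: x)
  case (Suc u)
  have m: "(tilt \<nu> q w' ^^ u) F \<in> borel_measurable E"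
    using tilts_measurable[of q "replicate u w'" F] dens w F by (simp add: foldr_replicate)
  have "(tilt \<nu> q w ^^ Suc u) F x \<le> tilt \<nu> q w (\<lambda>y. c ^ u * (tilt \<nu> q w' ^^ u) F y) x"
    using Suc by (auto intro!: tilt_mono)
  also have "\<dots> = c ^ u * tilt \<nu> q w ((tilt \<nu> q w' ^^ u) F) x"
    using Suc.prems m by (intro tilt_cmult dens w)
  finally have *: "(tilt \<nu> q w ^^ Suc u) F x \<le> c ^ u * tilt \<nu> q w ((tilt \<nu> q w' ^^ u) F) x" .
  have "tilt \<nu> q w ((tilt \<nu> q w' ^^ u) F) x
      \<le> (\<integral>\<^sup>+ z. c * (ennreal (q x z) * (w' x z * (tilt \<nu> q w' ^^ u) F (fst z))) \<partial>\<nu>)"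
    unfolding tilt_def[of \<nu> q w]
  proof (rule nn_integral_mono)
    fix z assume "z \<in> space \<nu>"
    then have "w x z \<le> c * w' x z" using le Suc.prems by auto
    then have "ennreal (q x z) * (w x z * (tilt \<nu> q w' ^^ u) F (fst z))
        \<le> ennreal (q x z) * ((c * w' x z) * (tilt \<nu> q w' ^^ u) F (fst z))"
      by (intro mult_left_mono mult_right_mono) auto
    then show "ennreal (q x z) * (w x z * (tilt \<nu> q w' ^^ u) F (fst z))
        \<le> c * (ennreal (q x z) * (w' x z * (tilt \<nu> q w' ^^ u) F (fst z)))"
      by (simp add: mult_ac)
  qed
  also have "\<dots> = c * tilt \<nu> q w' ((tilt \<nu> q w' ^^ u) F) x"
  proof -
    note [measurable] = density_section_measurable[OF dens Suc.prems]
      section_measurable[OF w(2) Suc.prems] m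
    show ?thesis unfolding tilt_def[of \<nu> q w' "(tilt \<nu> q w' ^^ u) F"]
      by (intro nn_integral_cmult) measurable
  qed
  finally have "c ^ u * tilt \<nu> q w ((tilt \<nu> q w' ^^ u) F) x
      \<le> c ^ u * (c * tilt \<nu> q w' ((tilt \<nu> q w' ^^ u) F) x)"
    by (intro mult_left_mono) auto
  with * show ?case by (simp add: mult_ac)
qed simp

text \<open>Applying the \<open>j\<close>-th iterate to the one-step inequality compares the masses
  after \<open>j + 1\<close> and \<open>j\<close> transitions; these comparisons telescope when
  added up. The gains \<open>d\<close> stay on the left so that nothing is subtracted in
  \<open>ennreal\<close>.\<close>

lemma tilt_pow_telescope:
  assumes dens: "semi_markov_density E \<nu> q" and w: "case_prod w \<in> borel_measurable (E \<Otimes>\<^sub>M \<nu>)"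
    and de: "d \<in> borel_measurable E" "e \<in> borel_measurable E"
    and le: "\<And>x. x \<in> space E \<Longrightarrow> tilt \<nu> q w (\<lambda>_. 1) x + d x \<le> 1 + e x"
    and x: "x \<in> space E"
  shows "(tilt \<nu> q w ^^ j) (\<lambda>_. 1) x + (\<Sum>u<j. (tilt \<nu> q w ^^ u) d x)
    \<le> 1 + (\<Sum>u<j. (tilt \<nu> q w ^^ u) e x)"
proof (induction j)
  case (Suc j)
  let ?T = "tilt \<nu> q w"
  have lin: "(?T ^^ j) (\<lambda>y. F y + G y) x = (?T ^^ j) F x + (?T ^^ j) G x"
    if "F \<in> borel_measurable E" "G \<in> borel_measurable E" for F G
    using tilts_add[of q "replicate j w" F G x] dens w x that by (simp add: foldr_replicate)
  have "(?T ^^ Suc j) (\<lambda>_. 1) x + (?T ^^ j) d x = (?T ^^ j) (\<lambda>y. ?T (\<lambda>_. 1) y + d y) x"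
    using tilt_measurable[OF dens w, of "\<lambda>_. 1"] de by (subst lin) (auto simp: funpow_swap1)
  also have "\<dots> \<le> (?T ^^ j) (\<lambda>y. 1 + e y) x"
    using tilts_mono[of "\<lambda>y. ?T (\<lambda>_. 1) y + d y" "\<lambda>y. 1 + e y" x q "replicate j w"] le x
    by (simp add: foldr_replicate)
  also have "\<dots> = (?T ^^ j) (\<lambda>_. 1) x + (?T ^^ j) e x"
    using de by (subst lin) auto
  finally have *: "(?T ^^ Suc j) (\<lambda>_. 1) x + (?T ^^ j) d x \<le> (?T ^^ j) (\<lambda>_. 1) x + (?T ^^ j) e x" .
  have "(?T ^^ Suc j) (\<lambda>_. 1) x + (\<Sum>u<Suc j. (?T ^^ u) d x)
      = ((?T ^^ Suc j) (\<lambda>_. 1) x + (?T ^^ j) d x) + (\<Sum>u<j. (?T ^^ u) d x)"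
    by (simp add: add_ac)
  also have "\<dots> \<le> ((?T ^^ j) (\<lambda>_. 1) x + (?T ^^ j) e x) + (\<Sum>u<j. (?T ^^ u) d x)"
    by (intro add_right_mono *)
  also have "\<dots> = ((?T ^^ j) (\<lambda>_. 1) x + (\<Sum>u<j. (?T ^^ u) d x)) + (?T ^^ j) e x"
    by (simp add: add_ac)
  also have "\<dots> \<le> (1 + (\<Sum>u<j. (?T ^^ u) e x)) + (?T ^^ j) e x"
    by (intro add_right_mono Suc)
  finally show ?case by (simp add: add_ac)
qed simp

lemma untilted_one: "semi_markov_density E \<nu> q \<Longrightarrow> x \<in> space E \<Longrightarrow> tilt \<nu> q untilted (\<lambda>_. 1) x = 1"
  by (simp add: tilt_def density_nn_integral)

lemma untilted_pow_one:
  assumes "semi_markov_density E \<nu> q" "x \<in> space E"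
  shows "(tilt \<nu> q untilted ^^ u) (\<lambda>_. 1) x = 1"
  using assms(2)
proof (induction u arbitrary: x)
  case (Suc u)
  then have "(tilt \<nu> q untilted ^^ Suc u) (\<lambda>_. 1) x = tilt \<nu> q untilted (\<lambda>_. 1) x"
    by (auto intro!: antisym tilt_mono)
  then show ?case using Suc.prems assms(1) by (simp add: untilted_one)
qed simp

section \<open>Kernels of the embedded chain as iterates of the untilted operator\<close>

lemma nn_integral_smk:
  assumes "semi_markov_density E \<nu> q" "x \<in> space E" "f \<in> borel_measurable \<nu>"
  shows "(\<integral>\<^sup>+ z. f z \<partial>smk \<nu> q x) = (\<integral>\<^sup>+ z. ennreal (q x z) * f z \<partial>\<nu>)"
  unfolding smk_def using assms density_section_measurable
  by (subst nn_integral_density) auto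

lemma sets_smk [simp, measurable_cong]: "sets (smk \<nu> q x) = sets (E \<Otimes>\<^sub>M borel_nonneg)"
  by (simp add: smk_def sets_nu)

lemma space_smk [simp]: "space (smk \<nu> q x) = space E \<times> {0..}"
  by (simp add: smk_def space_nu)

lemma smk_measurable:
  assumes q: "semi_markov_density E \<nu> q"
  shows "smk \<nu> q \<in> E \<rightarrow>\<^sub>M prob_algebra (E \<Otimes>\<^sub>M borel_nonneg)"
proof (rule measurable_prob_algebraI)
  fix x assume x: "x \<in> space E"
  have "emeasure (smk \<nu> q x) (space (smk \<nu> q x)) = (\<integral>\<^sup>+ z. 1 \<partial>smk \<nu> q x)" by simp
  also have "\<dots> = 1"
    using nn_integral_smk[OF q x, of "\<lambda>_. 1"] density_nn_integral[OF q x] by simp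
  finally show "prob_space (smk \<nu> q x)" by (rule prob_spaceI)
next
  have [measurable]: "case_prod q \<in> borel_measurable (E \<Otimes>\<^sub>M \<nu>)"
    by (rule density_measurable) fact
  show "smk \<nu> q \<in> E \<rightarrow>\<^sub>M subprob_algebra (E \<Otimes>\<^sub>M borel_nonneg)"
  proof (rule measurable_subprob_algebra)
    fix x assume x: "x \<in> space E"
    have "emeasure (smk \<nu> q x) (space (smk \<nu> q x)) = (\<integral>\<^sup>+ z. 1 \<partial>smk \<nu> q x)" by simp
    also have "\<dots> = 1"
      using nn_integral_smk[OF q x, of "\<lambda>_. 1"] density_nn_integral[OF q x] by simp
    finally show "subprob_space (smk \<nu> q x)" by (intro prob_space_imp_subprob_space prob_spaceI)
  next
    fix A assume "A \<in> sets (E \<Otimes>\<^sub>M borel_nonneg)"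
    then have [measurable]: "A \<in> sets \<nu>" by (simp add: sets_nu)
    have "(\<lambda>x. \<integral>\<^sup>+ z. ennreal (q x z) * indicator A z \<partial>\<nu>) \<in> borel_measurable E"
      by measurable
    moreover have "emeasure (smk \<nu> q x) A = (\<integral>\<^sup>+ z. ennreal (q x z) * indicator A z \<partial>\<nu>)"
      if x: "x \<in> space E" for x
      unfolding smk_def using density_section_measurable[OF q x]
      by (subst emeasure_density) auto
    ultimately show "(\<lambda>x. emeasure (smk \<nu> q x) A) \<in> borel_measurable E"
      by (simp cong: measurable_cong)
  qed simp
qed

lemma emc_kernel_measurable:
  assumes q: "semi_markov_density E \<nu> q"
  shows "emc_kernel E \<nu> q \<in> E \<rightarrow>\<^sub>M prob_algebra E"
  unfolding emc_kernel_def[abs_def]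
  by (rule measurable_distr_prob_space2[OF smk_measurable[OF q]]) measurable

lemma emc_kernel_n_measurable:
  assumes q: "semi_markov_density E \<nu> q"
  shows "emc_kernel_n E \<nu> q n \<in> E \<rightarrow>\<^sub>M prob_algebra E"
proof (induction n)
  case 0
  then show ?case using measurable_return_prob_space by (simp add: measurable_return_prob_space)
next
  case (Suc n)
  then show ?case
    by (simp add: measurable_bind_prob_space[OF emc_kernel_measurable[OF q]])
qed

lemma nn_integral_emc_kernel:
  assumes q: "semi_markov_density E \<nu> q" and x: "x \<in> space E" and F: "F \<in> borel_measurable E"
  shows "(\<integral>\<^sup>+ y. F y \<partial>emc_kernel E \<nu> q x) = tilt \<nu> q untilted F x"
proof -
  have "(\<integral>\<^sup>+ y. F y \<partial>emc_kernel E \<nu> q x) = (\<integral>\<^sup>+ z. F (fst z) \<partial>smk \<nu> q x)"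
    unfolding emc_kernel_def using F by (intro nn_integral_distr) measurable
  also have "\<dots> = tilt \<nu> q untilted F x"
    unfolding tilt_def using F by (subst nn_integral_smk[OF q x]) auto
  finally show ?thesis .
qed

lemma nn_integral_emc_kernel_n:
  assumes q: "semi_markov_density E \<nu> q" and x: "x \<in> space E" and F: "F \<in> borel_measurable E"
  shows "(\<integral>\<^sup>+ y. F y \<partial>emc_kernel_n E \<nu> q n x) = (tilt \<nu> q untilted ^^ n) F x"
  using x
proof (induction n arbitrary: x)
  case 0
  then show ?case using F by (simp add: nn_integral_return)
next
  case (Suc n)
  note N = measurable_prob_algebraD[OF emc_kernel_n_measurable[OF q, of n]]
  have s: "sets (emc_kernel E \<nu> q x) = sets E"
    by (simp add: emc_kernel_def)
  have "(\<integral>\<^sup>+ y. F y \<partial>emc_kernel_n E \<nu> q (Suc n) x)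
      = (\<integral>\<^sup>+ y. (\<integral>\<^sup>+ z. F z \<partial>emc_kernel_n E \<nu> q n y) \<partial>emc_kernel E \<nu> q x)"
    using nn_integral_bind[OF F, of "emc_kernel_n E \<nu> q n" "emc_kernel E \<nu> q x"] N
    by (simp cong: measurable_cong_sets[OF s])
  also have "\<dots> = tilt \<nu> q untilted (\<lambda>y. \<integral>\<^sup>+ z. F z \<partial>emc_kernel_n E \<nu> q n y) x"
    using nn_integral_measurable_subprob_algebra[OF F] N Suc.prems
    by (intro nn_integral_emc_kernel q) (auto intro: measurable_compose)
  also have "\<dots> = (tilt \<nu> q untilted ^^ Suc n) F x"
    using Suc by (auto intro!: antisym tilt_mono)
  finally show ?case .
qed

text \<open>The average of the first \<open>k\<close> kernels is itself a measure, namely the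
  mixture of the \<open>u\<close>-step laws over a uniform index \<open>u\<close>. The minorisation
  on sets is therefore an inequality of measures, and integrals are monotone in the measure.\<close>

lemma nn_integral_le_avg_tilt:
  assumes q: "semi_markov_density E \<nu> q" and x: "x \<in> space E" and k: "0 < k"
    and s: "sets \<mu> = sets E"
    and le: "\<And>B. B \<in> sets E \<Longrightarrow>
      emeasure \<mu> B \<le> (1 / of_nat k) * (\<Sum>u=1..k. emeasure (emc_kernel_n E \<nu> q u x) B)"
    and F: "F \<in> borel_measurable E"
  shows "(\<integral>\<^sup>+ y. F y \<partial>\<mu>) \<le> (1 / of_nat k) * (\<Sum>u=1..k. (tilt \<nu> q untilted ^^ u) F x)"
proof -
  let ?p = "measure_pmf (pmf_of_set {1..k})"
  let ?K = "\<lambda>u. emc_kernel_n E \<nu> q u x"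
  have K: "?K \<in> ?p \<rightarrow>\<^sub>M subprob_algebra E"
    using measurable_space[OF measurable_prob_algebraD[OF emc_kernel_n_measurable[OF q]] x]
    by (simp add: measurable_pmf_measure1)
  have ne: "{1..k} \<noteq> {}" using k by auto
  have avg: "(\<integral>\<^sup>+ u. g u \<partial>?p) = (1 / of_nat k) * (\<Sum>u=1..k. g u)" for g
    using ne by (simp add: nn_integral_pmf_of_set divide_ennreal_def mult.commute)
  have em: "emeasure (?p \<bind> ?K) A = (1 / of_nat k) * (\<Sum>u=1..k. emeasure (?K u) A)"
    if "A \<in> sets E" for A
    using emeasure_bind[OF _ K that] avg by simp
  have "\<mu> \<le> ?p \<bind> ?K"
  proof (subst le_measure)
    show "sets \<mu> = sets (?p \<bind> ?K)" using K s by (simp add: sets_bind_measurable)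
    show "\<forall>A\<in>sets \<mu>. emeasure \<mu> A \<le> emeasure (?p \<bind> ?K) A"
      using le s em by auto
  qed
  then have "(\<integral>\<^sup>+ y. F y \<partial>\<mu>) \<le> (\<integral>\<^sup>+ y. F y \<partial>(?p \<bind> ?K))"
    using K s by (intro nn_integral_mono_measure) (simp_all add: sets_bind_measurable)
  also have "\<dots> = (1 / of_nat k) * (\<Sum>u=1..k. (tilt \<nu> q untilted ^^ u) F x)"
    by (simp only: nn_integral_bind[OF F K] avg nn_integral_emc_kernel_n[OF q x F])
  finally show ?thesis .
qed

lemma tilt_pow_le_nn_integral:
  assumes q: "semi_markov_density E \<nu> q" and x: "x \<in> space E"
    and s: "sets \<mu> = sets E"
    and le: "\<And>B. B \<in> sets E \<Longrightarrow> emeasure (emc_kernel_n E \<nu> q l x) B \<le> emeasure \<mu> B"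
    and F: "F \<in> borel_measurable E"
  shows "(tilt \<nu> q untilted ^^ l) F x \<le> (\<integral>\<^sup>+ y. F y \<partial>\<mu>)"
proof -
  have "sets (emc_kernel_n E \<nu> q l x) = sets E"
    using measurable_space[OF emc_kernel_n_measurable[OF q] x] by (simp add: space_prob_algebra)
  then show ?thesis
    using le s unfolding nn_integral_emc_kernel_n[OF q x F, symmetric]
    by (intro nn_integral_mono_measure) (auto simp: le_measure)
qed

lemma stationary_nn_integral_pow:
  assumes q: "semi_markov_density E \<nu> q" and s: "sets \<rho> = sets E"
    and st: "\<rho> \<bind> emc_kernel E \<nu> q = \<rho>" and F: "F \<in> borel_measurable E"
  shows "(\<integral>\<^sup>+ x. (tilt \<nu> q untilted ^^ u) F x \<partial>\<rho>) = (\<integral>\<^sup>+ x. F x \<partial>\<rho>)"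
proof (induction u)
  case (Suc u)
  have m: "(tilt \<nu> q untilted ^^ u) F \<in> borel_measurable E"
    using tilts_measurable[OF q, of "replicate u untilted" F] F by (simp add: foldr_replicate)
  have N: "emc_kernel E \<nu> q \<in> \<rho> \<rightarrow>\<^sub>M subprob_algebra E"
    using measurable_prob_algebraD[OF emc_kernel_measurable[OF q]]
    by (simp cong: measurable_cong_sets[OF s])
  have "(\<integral>\<^sup>+ x. (tilt \<nu> q untilted ^^ u) F x \<partial>(\<rho> \<bind> emc_kernel E \<nu> q))
      = (\<integral>\<^sup>+ x. (\<integral>\<^sup>+ y. (tilt \<nu> q untilted ^^ u) F y \<partial>emc_kernel E \<nu> q x) \<partial>\<rho>)"
    by (rule nn_integral_bind[OF m N])
  also have "\<dots> = (\<integral>\<^sup>+ x. (tilt \<nu> q untilted ^^ Suc u) F x \<partial>\<rho>)"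
    using sets_eq_imp_space_eq[OF s] nn_integral_emc_kernel[OF q _ m]
    by (intro nn_integral_cong) auto
  finally show ?case using Suc st by simp
qed simp

section \<open>The one-step Hellinger bound and its accumulation over blocks\<close>

lemma hellinger_sq_measurable:
  assumes "semi_markov_density E \<nu> p" "semi_markov_density E \<nu> q"
  shows "hellinger_sq \<nu> p q \<in> borel_measurable E"
proof -
  note [measurable] = density_measurable[OF assms(1)] density_measurable[OF assms(2)]
  show ?thesis unfolding hellinger_sq_def[abs_def] by measurable
qed

lemma hellinger_weight_density_measurable:
  assumes "semi_markov_density E \<nu> p" "semi_markov_density E \<nu> q"
  shows "(\<lambda>(x, z). ennreal (hellinger_weight (p x z) (q x z))) \<in> borel_measurable (E \<Otimes>\<^sub>M \<nu>)"
proof -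
  note [measurable] = density_measurable[OF assms(1)] density_measurable[OF assms(2)]
  show ?thesis by measurable
qed

text \<open>The pointwise bound is integrated over \<open>\<nu>\<close>. The factor
  \<open>1 / 2\<close> in \<open>hellinger_sq\<close> doubles the constants \<open>1 / 12\<close>
  and \<open>4\<close> to \<open>1 / 6\<close> and \<open>8\<close>, and the corrections
  \<open>a / 6\<close> and \<open>b / 6\<close> both integrate to \<open>1 / 6\<close>.\<close>

lemma tilt_hellinger_weight_le:
  assumes dens: "semi_markov_density E \<nu> p" "semi_markov_density E \<nu> a" "semi_markov_density E \<nu> b"
    and x: "x \<in> space E"
  shows "tilt \<nu> p (\<lambda>x z. ennreal (hellinger_weight (a x z) (b x z))) (\<lambda>_. 1) x
      + ennreal (1 / 6) * hellinger_sq \<nu> a b x \<le> 1 + 8 * hellinger_sq \<nu> p b x"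
proof -
  note [measurable] = dens[THEN density_section_measurable[OF _ x]]
  let ?w = "\<lambda>z. ennreal (hellinger_weight (a x z) (b x z))"
  let ?h = "\<lambda>p q z. ennreal ((sqrt (p x z) - sqrt (q x z))\<^sup>2)"
  have half: "(1 / 2 :: ennreal) = ennreal (1 / 2)"
    using divide_ennreal[of 1 2] by simp
  have dist: "(\<integral>\<^sup>+ z. ennreal (c / 2) * ?h f g z \<partial>\<nu>) = ennreal c * hellinger_sq \<nu> f g x"
    if [measurable]: "f x \<in> borel_measurable \<nu>" "g x \<in> borel_measurable \<nu>" and "0 \<le> c" for f g c
  proof -
    have "(\<integral>\<^sup>+ z. ennreal (c / 2) * ?h f g z \<partial>\<nu>) = ennreal (c / 2) * (\<integral>\<^sup>+ z. ?h f g z \<partial>\<nu>)"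
      by (rule nn_integral_cmult) measurable
    moreover have "ennreal (c / 2) = ennreal c * ennreal (1 / 2)"
      using \<open>0 \<le> c\<close> by (subst ennreal_mult[symmetric]) simp_all
    ultimately show ?thesis by (simp only: hellinger_sq_def half mult.assoc)
  qed
  have scaled: "(\<integral>\<^sup>+ z. ennreal (1 / 6) * ennreal (f x z) \<partial>\<nu>) = ennreal (1 / 6)"
    if "semi_markov_density E \<nu> f" for f
    using density_nn_integral[OF that x] density_section_measurable[OF that x]
    by (subst nn_integral_cmult) auto
  have "(\<integral>\<^sup>+ z. ennreal (p x z) * ?w z + ennreal (1 / 12) * ?h a b z + ennreal (1 / 6) * ennreal (b x z) \<partial>\<nu>)
    \<le> (\<integral>\<^sup>+ z. ennreal (p x z) + ennreal (1 / 6) * ennreal (a x z) + ennreal 4 * ?h p b z \<partial>\<nu>)"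
  proof (rule nn_integral_mono)
    fix z assume "z \<in> space \<nu>"
    then have nn: "0 \<le> a x z" "0 \<le> b x z" "0 \<le> p x z"
      using dens x by (auto intro: density_nonneg)
    then have "0 \<le> hellinger_weight (a x z) (b x z)"
      using hellinger_weight_bounds(1)[of "a x z" "b x z"] by simp
    then show "ennreal (p x z) * ?w z + ennreal (1 / 12) * ?h a b z + ennreal (1 / 6) * ennreal (b x z)
      \<le> ennreal (p x z) + ennreal (1 / 6) * ennreal (a x z) + ennreal 4 * ?h p b z"
      using hellinger_weight_pointwise[OF nn] nn
      by (simp only: ennreal_mult[symmetric] ennreal_plus[symmetric] mult_nonneg_nonneg
          add_nonneg_nonneg zero_le_power2) (intro ennreal_leI, simp)
  qed
  also have "(\<integral>\<^sup>+ z. ennreal (p x z) * ?w z + ennreal (1 / 12) * ?h a b z + ennreal (1 / 6) * ennreal (b x z) \<partial>\<nu>)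
    = (tilt \<nu> p (\<lambda>x z. ennreal (hellinger_weight (a x z) (b x z))) (\<lambda>_. 1) x
      + ennreal (1 / 6) * hellinger_sq \<nu> a b x) + ennreal (1 / 6)"
    using scaled[of b] dens(3) dist[of a b "1 / 6"]
    by (subst nn_integral_add; (subst nn_integral_add)?) (simp_all add: tilt_def)
  also have "(\<integral>\<^sup>+ z. ennreal (p x z) + ennreal (1 / 6) * ennreal (a x z) + ennreal 4 * ?h p b z \<partial>\<nu>)
    = (1 + 8 * hellinger_sq \<nu> p b x) + ennreal (1 / 6)"
    using scaled[of a] dens(2) dist[of p b 8] density_nn_integral[OF dens(1) x]
    by (subst nn_integral_add; (subst nn_integral_add)?) (simp_all add: add_ac)
  \<comment> \<open>The common summand \<open>1 / 6\<close> is finite, so it cancels in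
    \<open>ennreal\<close>.\<close>
  finally show ?thesis
    by (simp add: add.commute[of _ "ennreal (1 / 6)"] ennreal_add_left_cancel_le)
qed

text \<open>Telescoping over the \<open>k + 1\<close> tilted transitions leaves sums of tilted
  iterates of \<open>d\<close> and \<open>e\<close>, and both are compared with untilted iterates.
  The gains lose at most the factor \<open>2 ^ k\<close>; the excesses grow by at most
  \<open>2 ^ u\<close> at index \<open>u\<close>, and the preceding \<open>l\<close> untilted
  transitions make \<open>R\<close> available for them.\<close>

lemma tilt_block_le:
  assumes q: "semi_markov_density E \<nu> q" and w: "case_prod w \<in> borel_measurable (E \<Otimes>\<^sub>M \<nu>)"
    and w_ge: "\<And>x z. x \<in> space E \<Longrightarrow> z \<in> space \<nu> \<Longrightarrow> 1 \<le> 2 * w x z"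
    and w_le: "\<And>x z. x \<in> space E \<Longrightarrow> z \<in> space \<nu> \<Longrightarrow> w x z \<le> 2"
    and d: "d \<in> borel_measurable E" and e: "e \<in> borel_measurable E"
    and le: "\<And>x. x \<in> space E \<Longrightarrow> tilt \<nu> q w (\<lambda>_. 1) x + d x \<le> 1 + e x"
    and lower: "\<And>x. x \<in> space E \<Longrightarrow> D \<le> (\<Sum>u=1..k. (tilt \<nu> q untilted ^^ u) d x)"
    and upper: "\<And>x. x \<in> space E \<Longrightarrow> (tilt \<nu> q untilted ^^ l) e x \<le> R"
    and x: "x \<in> space E"
  shows "(tilt \<nu> q untilted ^^ l) ((tilt \<nu> q w ^^ Suc k) (\<lambda>_. 1)) x + ennreal ((1 / 2) ^ k) * D
    \<le> 1 + 2 ^ Suc k * R"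
proof -
  let ?T = "tilt \<nu> q w" and ?P = "tilt \<nu> q untilted"
  have u: "case_prod untilted \<in> borel_measurable (E \<Otimes>\<^sub>M \<nu>)" by simp
  have mT: "(?T ^^ j) F \<in> borel_measurable E" if "F \<in> borel_measurable E" for j F
    using tilts_measurable[OF q, of "replicate j w" F] w that by (simp add: foldr_replicate)
  have mP: "(?P ^^ j) F \<in> borel_measurable E" if "F \<in> borel_measurable E" for j F
    using tilts_measurable[OF q, of "replicate j untilted" F] that by (simp add: foldr_replicate)
  have P_cmult: "(?P ^^ j) (\<lambda>y. c * F y) y = c * (?P ^^ j) F y"
    if "F \<in> borel_measurable E" "y \<in> space E" for c F j y
    using tilts_cmult[OF q, of "replicate j untilted" F y c] that by (simp add: foldr_replicate)
  have P_add: "(?P ^^ j) (\<lambda>y. F y + G y) y = (?P ^^ j) F y + (?P ^^ j) G y"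
    if "F \<in> borel_measurable E" "G \<in> borel_measurable E" "y \<in> space E" for F G j y
    using tilts_add[OF q, of "replicate j untilted" F G y] that by (simp add: foldr_replicate)
  have P_sum: "(?P ^^ j) (\<lambda>y. \<Sum>i\<in>A. F i y) y = (\<Sum>i\<in>A. (?P ^^ j) (F i) y)"
    if "\<And>i. F i \<in> borel_measurable E" "y \<in> space E" "finite A" for F A j y
    using tilts_sum[OF q, of "replicate j untilted" F y A] that by (simp add: foldr_replicate)
  have P_mono: "(?P ^^ j) F y \<le> (?P ^^ j) G y"
    if "\<And>y. y \<in> space E \<Longrightarrow> F y \<le> G y" "y \<in> space E" for F G j y
    using tilts_mono[of F G y q "replicate j untilted"] that by (simp add: foldr_replicate)
  have P_const: "(?P ^^ j) (\<lambda>_. c) y = c" if "y \<in> space E" for c j y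
    using P_cmult[of "\<lambda>_. 1" y j c] that untilted_pow_one[OF q] by simp
  \<comment> \<open>The telescoped sum runs over indices \<open>0\<close> to \<open>k\<close>,
    whereas the minorisation concerns \<open>1\<close> to \<open>k\<close>; this is why a block has
    \<open>k + 1\<close> tilted transitions. The term at index \<open>0\<close> is dropped.\<close>
  have lower': "ennreal ((1 / 2) ^ k) * D \<le> (\<Sum>u<Suc k. (?T ^^ u) d y)" if y: "y \<in> space E" for y
  proof -
    have "ennreal ((1 / 2) ^ k) * D \<le> ennreal ((1 / 2) ^ k) * (\<Sum>u=1..k. (?P ^^ u) d y)"
      using lower[OF y] by (intro mult_left_mono) auto
    also have "\<dots> = (\<Sum>u=1..k. ennreal ((1 / 2) ^ k) * (?P ^^ u) d y)"
      by (rule sum_distrib_left)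
    also have "\<dots> \<le> (\<Sum>u=1..k. (?T ^^ u) d y)"
    proof (rule sum_mono)
      fix u assume u: "u \<in> {1..k}"
      have "(?P ^^ u) d y \<le> 2 ^ u * (?T ^^ u) d y"
        using w_ge y by (intro tilt_le_scaled[OF q] w d) auto
      then have "ennreal ((1 / 2) ^ k) * (?P ^^ u) d y \<le> ennreal ((1 / 2) ^ k) * (2 ^ u * (?T ^^ u) d y)"
        by (intro mult_left_mono) auto
      also have "\<dots> = ennreal ((1 / 2) ^ k * 2 ^ u) * (?T ^^ u) d y"
        by (simp add: ennreal_mult ennreal_power[symmetric] mult.assoc)
      also have "\<dots> \<le> 1 * (?T ^^ u) d y"
      proof (rule mult_right_mono)
        have "(1 / 2 :: real) ^ k * 2 ^ u \<le> (1 / 2) ^ k * 2 ^ k"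
          using u by (intro mult_left_mono power_increasing) auto
        also have "\<dots> = 1" by (simp add: power_mult_distrib[symmetric])
        finally show "ennreal ((1 / 2) ^ k * 2 ^ u) \<le> 1"
          using ennreal_leI by fastforce
      qed simp
      finally show "ennreal ((1 / 2) ^ k) * (?P ^^ u) d y \<le> (?T ^^ u) d y" by simp
    qed
    also have "\<dots> \<le> (\<Sum>u<Suc k. (?T ^^ u) d y)"
      by (intro sum_mono2) auto
    finally show ?thesis .
  qed
  \<comment> \<open>Once the tilted iterate is replaced by the untilted one, the two untilted
    iterates commute. The \<open>l\<close> transitions can thus be applied to \<open>e\<close>
    first, where the bound \<open>R\<close> holds for every state, and the other \<open>u\<close>
    transitions preserve a constant.\<close>
  have upper': "(?P ^^ l) ((?T ^^ u) e) x \<le> 2 ^ u * R" for u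
  proof -
    have "(?P ^^ l) ((?T ^^ u) e) x \<le> (?P ^^ l) (\<lambda>y. 2 ^ u * (?P ^^ u) e y) x"
      using w_le x by (intro P_mono tilt_le_scaled[OF q] w e) auto
    also have "\<dots> = 2 ^ u * (?P ^^ (l + u)) e x"
      using mP e x by (subst P_cmult) (auto simp: funpow_add)
    also have "(?P ^^ (l + u)) e x = (?P ^^ u) ((?P ^^ l) e) x"
      by (simp add: funpow_add add.commute[of l])
    also have "2 ^ u * (?P ^^ u) ((?P ^^ l) e) x \<le> 2 ^ u * (?P ^^ u) (\<lambda>_. R) x"
      using upper x by (intro mult_left_mono P_mono) auto
    finally show ?thesis using P_const x by simp
  qed
  have "(?P ^^ l) ((?T ^^ Suc k) (\<lambda>_. 1)) x + ennreal ((1 / 2) ^ k) * D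
      = (?P ^^ l) (\<lambda>y. (?T ^^ Suc k) (\<lambda>_. 1) y + ennreal ((1 / 2) ^ k) * D) x"
    using P_add[of "(?T ^^ Suc k) (\<lambda>_. 1)" "\<lambda>_. ennreal ((1 / 2) ^ k) * D" x l]
      P_const[OF x, of l] mT[of "\<lambda>_. 1" "Suc k"] x by simp
  also have "\<dots> \<le> (?P ^^ l) (\<lambda>y. 1 + (\<Sum>u<Suc k. (?T ^^ u) e y)) x"
  proof (rule P_mono[OF _ x])
    fix y assume y: "y \<in> space E"
    have "(?T ^^ Suc k) (\<lambda>_. 1) y + ennreal ((1 / 2) ^ k) * D
        \<le> (?T ^^ Suc k) (\<lambda>_. 1) y + (\<Sum>u<Suc k. (?T ^^ u) d y)"
      using lower'[OF y] by (intro add_left_mono)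
    also have "\<dots> \<le> 1 + (\<Sum>u<Suc k. (?T ^^ u) e y)"
      by (rule tilt_pow_telescope[OF q w d e le y])
    finally show "(?T ^^ Suc k) (\<lambda>_. 1) y + ennreal ((1 / 2) ^ k) * D
        \<le> 1 + (\<Sum>u<Suc k. (?T ^^ u) e y)" .
  qed
  also have "\<dots> = 1 + (\<Sum>u<Suc k. (?P ^^ l) ((?T ^^ u) e) x)"
    using P_add[of "\<lambda>_. 1" "\<lambda>y. \<Sum>u<Suc k. (?T ^^ u) e y" x l] P_const[OF x, of l 1]
      P_sum[of "\<lambda>u. (?T ^^ u) e" x "{..<Suc k}" l] mT[OF e] x by (simp del: sum.lessThan_Suc)
  also have "\<dots> \<le> 1 + (\<Sum>u<Suc k. 2 ^ u * R)"
    by (intro add_left_mono sum_mono upper')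
  also have "(\<Sum>u<Suc k. 2 ^ u * R) \<le> 2 ^ Suc k * R"
  proof -
    \<comment> \<open>The geometric sum is stated with \<open>1\<close> added on the left, again to
      avoid subtraction in \<open>ennreal\<close>.\<close>
    have "(\<Sum>u<j. 2 ^ u :: ennreal) + 1 = 2 ^ j" for j
      by (induction j) (auto simp: mult_2 add_ac)
    then have "(\<Sum>u<Suc k. 2 ^ u :: ennreal) \<le> 2 ^ Suc k"
      by (metis le_iff_add)
    then show ?thesis by (simp only: sum_distrib_right[symmetric]) (intro mult_right_mono, auto)
  qed
  finally show ?thesis by (simp add: add_left_mono)
qed

text \<open>Each block starts with \<open>l\<close> neutral transitions: after them the conditional law of the state is
  dominated by \<open>\<eta>*\<close> whatever the past, which is what controls the local excess \<open>e\<close> in \<open>tilt_block_le\<close>.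
  The leading single factor is taken under the stationary law and makes the bound nontrivial
  even when \<open>n\<close> is smaller than one block.\<close>

definition block_weights :: "('a \<Rightarrow> 'a \<times> real \<Rightarrow> ennreal) \<Rightarrow> nat \<Rightarrow> nat \<Rightarrow> nat \<Rightarrow> nat
    \<Rightarrow> ('a \<Rightarrow> 'a \<times> real \<Rightarrow> ennreal) list" where
  "block_weights w l k m r =
     w # concat (replicate m (replicate l untilted @ replicate (Suc k) w)) @ replicate r untilted"

lemma length_block_weights: "length (block_weights w l k m r) = Suc (m * (l + Suc k) + r)"
  by (simp add: block_weights_def length_concat sum_list_replicate)

lemma set_block_weights: "set (block_weights w l k m r) \<subseteq> {w, untilted}"
  by (auto simp: block_weights_def)

text \<open>The bound for one block holds from every starting state, so blocks split off one at a
  time from the front. The trailing neutral transitions preserve the constant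
  \<open>1\<close>.\<close>

lemma tilts_blocks_le:
  assumes q: "semi_markov_density E \<nu> q" and w: "case_prod w \<in> borel_measurable (E \<Otimes>\<^sub>M \<nu>)"
    and block: "\<And>x. x \<in> space E \<Longrightarrow>
      (tilt \<nu> q untilted ^^ l) ((tilt \<nu> q w ^^ Suc k) (\<lambda>_. 1)) x \<le> c"
    and x: "x \<in> space E"
  shows "foldr (tilt \<nu> q) (concat (replicate m (replicate l untilted @ replicate (Suc k) w))
      @ replicate r untilted) (\<lambda>_. 1) x \<le> c ^ m"
  using x
proof (induction m arbitrary: x)
  case 0
  then show ?case using untilted_pow_one[OF q] by (simp add: foldr_replicate)
next
  case (Suc m)
  let ?b = "replicate l untilted @ replicate (Suc k) w"
  let ?F = "foldr (tilt \<nu> q) (concat (replicate m ?b) @ replicate r untilted) (\<lambda>_. 1)"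
  have "foldr (tilt \<nu> q) ?b ?F x \<le> c ^ m * foldr (tilt \<nu> q) ?b (\<lambda>_. 1) x"
    using Suc w by (intro tilts_le_const[OF q]) (auto split: if_splits)
  also have "foldr (tilt \<nu> q) ?b (\<lambda>_. 1) x
      = (tilt \<nu> q untilted ^^ l) ((tilt \<nu> q w ^^ Suc k) (\<lambda>_. 1)) x"
    by (simp only: foldr_append foldr_replicate)
  also have "c ^ m * \<dots> \<le> c ^ m * c"
    using block[OF Suc.prems] by (rule mult_left_mono) simp
  also have "foldr (tilt \<nu> q) ?b ?F
      = foldr (tilt \<nu> q) (concat (replicate (Suc m) ?b) @ replicate r untilted) (\<lambda>_. 1)"
    by (simp only: replicate_Suc[of m] concat.simps foldr_append append_assoc)
  finally show ?case by (simp only: power_Suc2)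
qed

text \<open>All blocks are bounded by \<open>c ^ m\<close> uniformly in the state reached by the
  leading transition. Only that transition is integrated against \<open>\<rho>\<close>, and it
  supplies the additional factor \<open>c\<close>.\<close>

lemma nn_integral_block_weights_le:
  assumes q: "semi_markov_density E \<nu> q" and w: "case_prod w \<in> borel_measurable (E \<Otimes>\<^sub>M \<nu>)"
    and block: "\<And>x. x \<in> space E \<Longrightarrow>
      (tilt \<nu> q untilted ^^ l) ((tilt \<nu> q w ^^ Suc k) (\<lambda>_. 1)) x \<le> c"
    and s: "sets \<rho> = sets E"
    and first: "(\<integral>\<^sup>+ x. tilt \<nu> q w (\<lambda>_. 1) x \<partial>\<rho>) \<le> c"
  shows "(\<integral>\<^sup>+ x. foldr (tilt \<nu> q) (block_weights w l k m r) (\<lambda>_. 1) x \<partial>\<rho>) \<le> c ^ Suc m"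
proof -
  let ?G = "foldr (tilt \<nu> q) (concat (replicate m (replicate l untilted @ replicate (Suc k) w))
      @ replicate r untilted) (\<lambda>_. 1)"
  have sp: "space \<rho> = space E" by (rule sets_eq_imp_space_eq[OF s])
  have "(\<integral>\<^sup>+ x. foldr (tilt \<nu> q) [w] ?G x \<partial>\<rho>) \<le> (\<integral>\<^sup>+ x. c ^ m * foldr (tilt \<nu> q) [w] (\<lambda>_. 1) x \<partial>\<rho>)"
    using w sp by (intro nn_integral_mono tilts_le_const[OF q] tilts_blocks_le[OF q w block]) auto
  also have "\<dots> = c ^ m * (\<integral>\<^sup>+ x. tilt \<nu> q w (\<lambda>_. 1) x \<partial>\<rho>)"
    using tilt_measurable[OF q w, of "\<lambda>_. 1"] 
    by (subst nn_integral_cmult) (auto simp: measurable_cong_sets[OF s])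
  also have "\<dots> \<le> c ^ m * c" by (intro mult_left_mono first) auto
  finally show ?thesis by (simp add: block_weights_def mult.commute)
qed

end

section \<open>The law of the observed history\<close>

text \<open>The renewal property is given only for sojourn times at most \<open>t\<close>, so the
  half-line needs the intervals \<open>{0..t}\<close> as a generator. They are the nonempty traces
  of the rays \<open>{..t}\<close>, which generate the Borel sets of the line.\<close>

lemma sets_borel_nonneg: "sets borel_nonneg = sigma_sets {0..} {{0..t} | t. 0 \<le> t}"
proof -
  have "sets borel_nonneg = (\<inter>) {0..} ` sigma_sets UNIV (range (\<lambda>t::real. {..t}))"
    by (simp only: sets_restrict_space borel_eq_atMost sets_measure_of[OF subset_Pow_Union[of "range atMost", THEN subset_trans]])
       (simp add: sets_measure_of_conv)
  also have "\<dots> = sigma_sets {0..} ((\<inter>) {0..} ` range (\<lambda>t::real. {..t}))"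
  proof (rule sigma_sets_Int)
    have "{0..} \<in> sets (borel :: real measure)" by simp
    then show "{0::real..} \<in> sigma_sets UNIV (range atMost)"
      by (simp add: borel_eq_atMost sets_measure_of_conv)
  qed simp
  also have "\<dots> = sigma_sets {0..} {{0..t} | t. 0 \<le> t}"
  proof (rule sigma_sets_eqI)
    fix a assume "a \<in> (\<inter>) {0..} ` range (\<lambda>t::real. {..t})"
    then obtain t where t: "a = {0..} \<inter> {..t}" by auto
    show "a \<in> sigma_sets {0..} {{0..t} | t. 0 \<le> t}"
    proof (cases "0 \<le> t")
      case True
      then have "a = {0..t}" using t by auto
      then show ?thesis using True by (auto intro: sigma_sets.Basic)
    next
      case False
      then have "a = {}" using t by auto
      then show ?thesis by (simp add: sigma_sets.Empty)
    qed
  next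
    fix b assume "b \<in> {{0..t} | t::real. 0 \<le> t}"
    then obtain t where "b = {0..t}" by auto
    then have "b = {0..} \<inter> {..t}" by auto
    then show "b \<in> sigma_sets {0..} ((\<inter>) {0..} ` range (\<lambda>t::real. {..t}))"
      by (intro sigma_sets.Basic) auto
  qed
  finally show ?thesis .
qed

lemma sets_mark_space:
  "sets (E \<Otimes>\<^sub>M borel_nonneg)
    = sigma_sets (space E \<times> {0..}) {B \<times> {0..t} | B t. B \<in> sets E \<and> 0 \<le> t}"
proof -
  have "(\<Union>m. {0..real m}) = {0..}"
    by (auto intro: real_arch_simple)
  then have cover: "\<Union>(range (\<lambda>m. {0..real m})) = space borel_nonneg"
    by (simp add: space_restrict_space)
  have "sets (E \<Otimes>\<^sub>M borel_nonneg) = sets (sigma (space E \<times> space borel_nonneg)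
      {a \<times> b | a b. a \<in> sets E \<and> b \<in> {{0..t} | t::real. 0 \<le> t}})"
  proof (rule sets_pair_eq)
    show "sets E \<subseteq> Pow (space E)" by (rule sets.space_closed)
    show "sets E = sigma_sets (space E) (sets E)" by (simp add: sets.sigma_sets_eq)
    show "countable {space E}" "{space E} \<subseteq> sets E" "\<Union>{space E} = space E" by auto
    show "{{0..t} | t::real. 0 \<le> t} \<subseteq> Pow (space borel_nonneg)" by (auto simp: space_restrict_space)
    show "sets borel_nonneg = sigma_sets (space borel_nonneg) {{0..t} | t. 0 \<le> t}"
      unfolding sets_borel_nonneg by (simp add: space_restrict_space)
    show "range (\<lambda>m. {0..real m}) \<subseteq> {{0..t} | t. 0 \<le> t}" by auto
  qed (use cover in auto)
  also have "\<dots> = sigma_sets (space E \<times> {0..})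
      {a \<times> b | a b. a \<in> sets E \<and> b \<in> {{0..t} | t::real. 0 \<le> t}}"
    by (subst sets_measure_of) (auto simp: space_restrict_space dest: sets.sets_into_space)
  also have "{a \<times> b | a b. a \<in> sets E \<and> b \<in> {{0..t} | t::real. 0 \<le> t}}
      = {B \<times> {0..t} | B t. B \<in> sets E \<and> 0 \<le> t}" by blast
  finally show ?thesis .
qed

text \<open>Uniqueness of measures on a generator closed under intersection: two intervals from
  \<open>0\<close> meet in the shorter one. The boxes with sides \<open>{0..real m}\<close> exhaust
  the space, and finiteness of \<open>N1\<close> makes their masses finite.\<close>

lemma measure_eqI_mark_product:
  fixes N1 N2 :: "('h \<times> 'a \<times> real) measure"
  assumes sets: "sets N1 = sets (H \<Otimes>\<^sub>M (E \<Otimes>\<^sub>M borel_nonneg))"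
      "sets N2 = sets (H \<Otimes>\<^sub>M (E \<Otimes>\<^sub>M borel_nonneg))"
    and fin: "finite_measure N1"
    and eq: "\<And>C B t. C \<in> sets H \<Longrightarrow> B \<in> sets E \<Longrightarrow> 0 \<le> t \<Longrightarrow>
      emeasure N1 (C \<times> B \<times> {0..t}) = emeasure N2 (C \<times> B \<times> {0..t})"
  shows "N1 = N2"
proof -
  interpret finite_measure N1 by (rule fin)
  let ?R = "{B \<times> {0..t} | B t. B \<in> sets E \<and> (0::real) \<le> t}"
  let ?G = "{C \<times> R | C R. C \<in> sets H \<and> R \<in> ?R}"
  let ?O = "space H \<times> space (E \<Otimes>\<^sub>M borel_nonneg)"
  have spZ: "space (E \<Otimes>\<^sub>M borel_nonneg) = space E \<times> {0..}"
    by (simp add: space_pair_measure space_restrict_space)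
  have "(\<Union>m. {0..real m}) = {0..}"
    by (auto intro: real_arch_simple)
  then have cover: "(\<Union>m. space E \<times> {0..real m}) = space E \<times> {0..}"
    by blast
  have cover_R: "space E \<times> {0..real m} \<in> ?R" for m
    by (intro CollectI exI[of _ "space E"] exI[of _ "real m"]) auto
  have R: "?R \<subseteq> Pow (space E \<times> {0..})" by (auto dest: sets.sets_into_space)
  have "sets (H \<Otimes>\<^sub>M (E \<Otimes>\<^sub>M borel_nonneg)) = sets (sigma ?O ?G)"
  proof (rule sets_pair_eq)
    show "sets H \<subseteq> Pow (space H)" by (rule sets.space_closed)
    show "sets H = sigma_sets (space H) (sets H)" by (simp add: sets.sigma_sets_eq)
    show "countable {space H}" "{space H} \<subseteq> sets H" "\<Union>{space H} = space H" by auto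
    show "range (\<lambda>m. space E \<times> {0..real m}) \<subseteq> ?R"
      using cover_R by (intro image_subsetI)
    show "sets (E \<Otimes>\<^sub>M borel_nonneg) = sigma_sets (space (E \<Otimes>\<^sub>M borel_nonneg)) ?R"
      unfolding spZ by (rule sets_mark_space)
  qed (use cover R in \<open>auto simp: spZ\<close>)
  also have "\<dots> = sigma_sets ?O ?G"
    using R by (subst sets_measure_of) (auto simp: spZ dest: sets.sets_into_space)
  finally have gen: "sets (H \<Otimes>\<^sub>M (E \<Otimes>\<^sub>M borel_nonneg)) = sigma_sets ?O ?G" .
  show ?thesis
  proof (rule measure_eqI_generator_eq[where A = "\<lambda>m. space H \<times> space E \<times> {0..real m}"])
    show "Int_stable ?G"
    proof (rule Int_stableI)
      fix a b assume "a \<in> ?G" "b \<in> ?G"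
      then obtain C B t C' B' t' where ab: "a = C \<times> B \<times> {0..t}" "b = C' \<times> B' \<times> {0..t'}"
        and mem: "C \<in> sets H" "C' \<in> sets H" "B \<in> sets E" "B' \<in> sets E" "0 \<le> t" "0 \<le> t'"
        by auto
      have "a \<inter> b = (C \<inter> C') \<times> (B \<inter> B') \<times> {0..min t t'}"
        unfolding ab by auto
      moreover have "(B \<inter> B') \<times> {0..min t t'} \<in> ?R"
        using mem by (intro CollectI exI[of _ "B \<inter> B'"] exI[of _ "min t t'"]) auto
      ultimately show "a \<inter> b \<in> ?G"
        using mem by (intro CollectI exI[of _ "C \<inter> C'"] exI[of _ "(B \<inter> B') \<times> {0..min t t'}"] conjI)
          (auto simp only: sets.Int)
    qed
    show "?G \<subseteq> Pow ?O" using R by (auto simp: spZ dest: sets.sets_into_space)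
    show "emeasure N1 X = emeasure N2 X" if "X \<in> ?G" for X using that eq by auto
    show "range (\<lambda>m. space H \<times> space E \<times> {0..real m}) \<subseteq> ?G"
    proof (rule image_subsetI)
      show "space H \<times> space E \<times> {0..real m} \<in> ?G" for m
        by (intro CollectI exI[of _ "space H"] exI[of _ "space E \<times> {0..real m}"] conjI
            refl sets.top cover_R)
    qed
    show "(\<Union>m. space H \<times> space E \<times> {0..real m}) = ?O"
      unfolding spZ cover[symmetric] by blast
  qed (simp_all add: sets gen)
qed

section \<open>The joint law of the history and the next transition\<close>

lemma history_measurable:
  assumes "markov_renewal_process E \<nu> q M J S"
  shows "history J S n \<in> M \<rightarrow>\<^sub>M history_space E n"
proof -
  have [measurable]: "J i \<in> M \<rightarrow>\<^sub>M E" "S i \<in> M \<rightarrow>\<^sub>M borel_nonneg" for i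
    using assms by (auto simp: markov_renewal_process_def)
  show ?thesis
    unfolding history_def[abs_def] history_space_def by (rule measurable_restrict) measurable
qed

lemma sojourn_measurable:
  assumes "markov_renewal_process E \<nu> q M J S"
  shows "sojourn S (Suc n) \<in> M \<rightarrow>\<^sub>M borel_nonneg"
proof (rule measurable_restrict_space2)
  have "S i \<in> borel_measurable M" for i
    using assms measurable_restrict_space2_iff[of "S i" M borel "{0..}"]
    by (auto simp: markov_renewal_process_def)
  note [measurable] = this
  show "sojourn S (Suc n) \<in> borel_measurable M"
    unfolding sojourn_def[abs_def] by simp
  show "sojourn S (Suc n) \<in> space M \<rightarrow> {0..}"
    using assms by (auto simp: markov_renewal_process_def sojourn_def)
qed

text \<open>\<open>history_space\<close> also contains histories with decreasing jump times; the truncation at \<open>0\<close> keeps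
  their increments in the domain of the densities.\<close>

definition path_weight ::
    "('a \<Rightarrow> 'a \<times> real \<Rightarrow> ennreal) list \<Rightarrow> (nat \<Rightarrow> 'a \<times> real) \<Rightarrow> ennreal" where
  "path_weight ws h =
     (\<Prod>i<length ws. (ws ! i) (fst (h i)) (fst (h (Suc i)), max 0 (snd (h (Suc i)) - snd (h i))))"

context smk_space
begin

text \<open>The event that the history lies in \<open>C\<close> belongs to the conditioning algebra.
  Integrating the defining conditional probability over it gives the joint law on rectangles, free
  of conditional expectations.\<close>

lemma markov_renewal_transition_prob:
  assumes q: "semi_markov_density E \<nu> q" and mrp: "markov_renewal_process E \<nu> q M J S"
    and C: "C \<in> sets (history_space E n)" and B: "B \<in> sets E" and t: "0 \<le> t"
  shows "emeasure M {\<omega> \<in> space M. history J S n \<omega> \<in> C \<and> J (Suc n) \<omega> \<in> B \<and> sojourn S (Suc n) \<omega> \<le> t}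
    = (\<integral>\<^sup>+ \<omega>. indicator C (history J S n \<omega>) * emeasure (smk \<nu> q (J n \<omega>)) (B \<times> {0..t}) \<partial>M)"
proof -
  interpret prob_space M using mrp by (simp add: markov_renewal_process_def)
  note [measurable] = history_measurable[OF mrp] sojourn_measurable[OF mrp]
    measurable_prob_algebraD[OF smk_measurable[OF q]] C B
  have J [measurable]: "J i \<in> M \<rightarrow>\<^sub>M E" for i
    using mrp by (auto simp: markov_renewal_process_def)
  have soj [measurable]: "sojourn S (Suc n) \<in> borel_measurable M"
    using measurable_restrict_space2_iff[of "sojourn S (Suc n)" M borel "{0..}"] sojourn_measurable[OF mrp]
    by blast
  let ?F = "history_algebra E M J S n"
  let ?A = "history J S n -` C \<inter> space M"
  let ?D = "{\<omega> \<in> space M. J (Suc n) \<omega> \<in> B \<and> sojourn S (Suc n) \<omega> \<le> t}"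
  let ?g = "\<lambda>\<omega>. measure (smk \<nu> q (J n \<omega>)) (B \<times> {0..t})"
  have "subalgebra M ?F"
    using measurable_sets[OF history_measurable[OF mrp]]
    by (auto simp: subalgebra_def history_algebra_def sets_vimage_algebra2
        measurable_space[OF history_measurable[OF mrp]])
  then interpret finite_measure_subalgebra M ?F
    by unfold_locales
  have I [measurable]: "{0..t} \<in> sets borel_nonneg"
    by (auto simp: sets_restrict_space_iff)
  have BI [measurable]: "B \<times> {0..t} \<in> sets (E \<Otimes>\<^sub>M borel_nonneg)"
    using B I by (rule pair_measureI)
  have A: "?A \<in> sets ?F" "?A \<in> sets M"
    using C measurable_space[OF history_measurable[OF mrp]]
    by (auto simp: history_algebra_def in_vimage_algebra)
  have D [measurable]: "?D \<in> sets M" by measurable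
  have g [measurable]: "?g \<in> borel_measurable M"
    by (rule measurable_compose[OF J[of n]]) measurable
  have ps: "prob_space (smk \<nu> q (J n \<omega>))" if "\<omega> \<in> space M" for \<omega>
    using measurable_space[OF smk_measurable[OF q]] measurable_space[OF J that]
    by (auto simp: space_prob_algebra)
  have ae: "AE \<omega> in M. real_cond_exp M ?F (indicator ?D) \<omega> = ?g \<omega>"
    using mrp B t unfolding markov_renewal_process_def by blast
  \<comment> \<open>The defining property of conditional expectation is applied over
    \<open>?A\<close>; afterwards the conditional expectation is replaced by its almost sure version
    \<open>?g\<close>.\<close>
  have "measure M (?A \<inter> ?D) = (\<integral>\<omega>\<in>?A. indicator ?D \<omega> \<partial>M)"
    using A D by (simp add: set_lebesgue_integral_def indicator_inter_arith[symmetric])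
  also have "\<dots> = (\<integral>\<omega>\<in>?A. real_cond_exp M ?F (indicator ?D) \<omega> \<partial>M)"
    using A D by (intro real_cond_exp_intA) (auto simp: emeasure_eq_measure)
  also have "\<dots> = (\<integral>\<omega>. indicator ?A \<omega> * ?g \<omega> \<partial>M)"
    unfolding set_lebesgue_integral_def using ae A by (intro integral_cong_AE) auto
  finally have m: "measure M (?A \<inter> ?D) = (\<integral>\<omega>. indicator ?A \<omega> * ?g \<omega> \<partial>M)" .
  \<comment> \<open>The change to a nonnegative integral is harmless because \<open>?g\<close> is a
    probability, so the integrand is bounded by \<open>1\<close>.\<close>
  have "emeasure M (?A \<inter> ?D) = (\<integral>\<^sup>+ \<omega>. ennreal (indicator ?A \<omega> * ?g \<omega>) \<partial>M)"
    unfolding emeasure_eq_measure m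
  proof (rule nn_integral_eq_integral[symmetric])
    show "integrable M (\<lambda>\<omega>. indicator ?A \<omega> * ?g \<omega>)"
      using ps A prob_space.prob_le_1
      by (intro integrable_const_bound[of _ 1]) (auto simp: indicator_def)
  qed (simp add: indicator_def)
  also have "\<dots> = (\<integral>\<^sup>+ \<omega>. indicator C (history J S n \<omega>) * emeasure (smk \<nu> q (J n \<omega>)) (B \<times> {0..t}) \<partial>M)"
  proof (rule nn_integral_cong)
    fix \<omega> assume \<omega>: "\<omega> \<in> space M"
    interpret s: prob_space "smk \<nu> q (J n \<omega>)" by (rule ps[OF \<omega>])
    show "ennreal (indicator ?A \<omega> * ?g \<omega>)
      = indicator C (history J S n \<omega>) * emeasure (smk \<nu> q (J n \<omega>)) (B \<times> {0..t})"
      using \<omega> by (auto simp: s.emeasure_eq_measure indicator_def)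
  qed
  also have "?A \<inter> ?D = {\<omega> \<in> space M. history J S n \<omega> \<in> C \<and> J (Suc n) \<omega> \<in> B \<and> sojourn S (Suc n) \<omega> \<le> t}"
    by auto
  finally show ?thesis .
qed

text \<open>The joint law of history and next transition agrees on rectangles with the mixture that
  first draws the history and then a transition from the kernel. The two measures therefore
  coincide, and the claim is integration against both.\<close>

lemma nn_integral_markov_renewal_transition:
  assumes q: "semi_markov_density E \<nu> q" and mrp: "markov_renewal_process E \<nu> q M J S"
    and f: "f \<in> borel_measurable (history_space E n \<Otimes>\<^sub>M (E \<Otimes>\<^sub>M borel_nonneg))"
  shows "(\<integral>\<^sup>+ \<omega>. f (history J S n \<omega>, J (Suc n) \<omega>, sojourn S (Suc n) \<omega>) \<partial>M)
    = (\<integral>\<^sup>+ \<omega>. \<integral>\<^sup>+ z. f (history J S n \<omega>, z) \<partial>smk \<nu> q (J n \<omega>) \<partial>M)"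
proof -
  interpret prob_space M using mrp by (simp add: markov_renewal_process_def)
  let ?H = "history_space E n"
  let ?Z = "E \<Otimes>\<^sub>M borel_nonneg"
  note [measurable] = history_measurable[OF mrp] sojourn_measurable[OF mrp]
  have J [measurable]: "J i \<in> M \<rightarrow>\<^sub>M E" for i
    using mrp by (auto simp: markov_renewal_process_def)
  let ?N1 = "distr M (?H \<Otimes>\<^sub>M ?Z) (\<lambda>\<omega>. (history J S n \<omega>, J (Suc n) \<omega>, sojourn S (Suc n) \<omega>))"
  \<comment> \<open>For fixed \<open>\<omega>\<close> this is the law of the pair formed by the
    realised history and a fresh transition from its last state.\<close>
  let ?K = "\<lambda>\<omega>. distr (smk \<nu> q (J n \<omega>)) (?H \<Otimes>\<^sub>M ?Z) (Pair (history J S n \<omega>))"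
  have "?K \<in> M \<rightarrow>\<^sub>M prob_algebra (?H \<Otimes>\<^sub>M ?Z)"
    by (rule measurable_distr_prob_space2[OF measurable_compose[OF J smk_measurable[OF q]]]) measurable
  then have K: "?K \<in> M \<rightarrow>\<^sub>M subprob_algebra (?H \<Otimes>\<^sub>M ?Z)"
    by (rule measurable_prob_algebraD)
  have P: "Pair (history J S n \<omega>) \<in> smk \<nu> q x \<rightarrow>\<^sub>M ?H \<Otimes>\<^sub>M ?Z" if "\<omega> \<in> space M" for \<omega> x
    using measurable_space[OF history_measurable[OF mrp] that] by measurable
  have "?N1 = M \<bind> ?K"
  proof (rule measure_eqI_mark_product[where H = ?H and E = E])
    show "sets (M \<bind> ?K) = sets (?H \<Otimes>\<^sub>M ?Z)"
      by (rule sets_bind_measurable[OF K not_empty])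
    show "finite_measure ?N1"
      by (intro prob_space.finite_measure prob_space_distr) measurable
    fix C B t assume *: "C \<in> sets ?H" "B \<in> sets E" "0 \<le> (t::real)"
    then have I: "{0..t} \<in> sets borel_nonneg"
      by (auto simp: sets_restrict_space_iff)
    have BI: "B \<times> {0..t} \<in> sets ?Z"
      using * I by (intro pair_measureI)
    have X: "C \<times> B \<times> {0..t} \<in> sets (?H \<Otimes>\<^sub>M ?Z)"
      by (rule pair_measureI[OF *(1) BI])
    \<comment> \<open>The event only requires the sojourn time to be at most \<open>t\<close>; it is
      the preimage of the rectangle because sojourn times are nonnegative.\<close>
    have "emeasure ?N1 (C \<times> B \<times> {0..t})
        = emeasure M {\<omega> \<in> space M. history J S n \<omega> \<in> C \<and> J (Suc n) \<omega> \<in> B \<and> sojourn S (Suc n) \<omega> \<le> t}"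
      using X measurable_space[OF sojourn_measurable[OF mrp, of n]]
      by (subst emeasure_distr) (auto simp: space_restrict_space intro!: arg_cong[where f = "emeasure M"])
    also have "\<dots> = (\<integral>\<^sup>+ \<omega>. indicator C (history J S n \<omega>) * emeasure (smk \<nu> q (J n \<omega>)) (B \<times> {0..t}) \<partial>M)"
      using * by (rule markov_renewal_transition_prob[OF q mrp])
    also have "\<dots> = (\<integral>\<^sup>+ \<omega>. emeasure (?K \<omega>) (C \<times> B \<times> {0..t}) \<partial>M)"
    proof (rule nn_integral_cong)
      fix \<omega> assume \<omega>: "\<omega> \<in> space M"
      have "Pair (history J S n \<omega>) -` (C \<times> B \<times> {0..t}) \<inter> space (smk \<nu> q (J n \<omega>))
          = (if history J S n \<omega> \<in> C then B \<times> {0..t} else {})"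
        using sets.sets_into_space[OF BI] by (auto simp: space_pair_measure space_restrict_space)
      then show "indicator C (history J S n \<omega>) * emeasure (smk \<nu> q (J n \<omega>)) (B \<times> {0..t})
          = emeasure (?K \<omega>) (C \<times> B \<times> {0..t})"
        using X P[OF \<omega>] by (subst emeasure_distr) (auto simp: indicator_def)
    qed
    also have "\<dots> = emeasure (M \<bind> ?K) (C \<times> B \<times> {0..t})"
      by (rule emeasure_bind[OF not_empty K X, symmetric])
    finally show "emeasure ?N1 (C \<times> B \<times> {0..t}) = emeasure (M \<bind> ?K) (C \<times> B \<times> {0..t})" .
  qed simp
  moreover have "(\<integral>\<^sup>+ v. f v \<partial>?N1) = (\<integral>\<^sup>+ \<omega>. f (history J S n \<omega>, J (Suc n) \<omega>, sojourn S (Suc n) \<omega>) \<partial>M)"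
  proof (rule nn_integral_distr)
    show "(\<lambda>\<omega>. (history J S n \<omega>, J (Suc n) \<omega>, sojourn S (Suc n) \<omega>)) \<in> M \<rightarrow>\<^sub>M ?H \<Otimes>\<^sub>M ?Z"
      by measurable
    show "f \<in> borel_measurable ?N1" using f by (simp only: measurable_distr_eq1)
  qed
  moreover have "(\<integral>\<^sup>+ v. f v \<partial>(M \<bind> ?K)) = (\<integral>\<^sup>+ \<omega>. \<integral>\<^sup>+ z. f (history J S n \<omega>, z) \<partial>smk \<nu> q (J n \<omega>) \<partial>M)"
    unfolding nn_integral_bind[OF f K]
  proof (rule nn_integral_cong)
    fix \<omega> assume "\<omega> \<in> space M"
    then show "(\<integral>\<^sup>+ v. f v \<partial>?K \<omega>) = (\<integral>\<^sup>+ z. f (history J S n \<omega>, z) \<partial>smk \<nu> q (J n \<omega>))"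
      by (intro nn_integral_distr[OF P]) (simp_all only: measurable_distr_eq1 f)
  qed
  ultimately show ?thesis by simp
qed

section \<open>Expectations of path weights\<close>

lemma history_space_component:
  assumes "h \<in> space (history_space E n)" "i \<le> n"
  shows "fst (h i) \<in> space E" "0 \<le> snd (h i)"
proof -
  have "h i \<in> space (E \<Otimes>\<^sub>M borel_nonneg)"
    using assms by (auto simp: history_space_def space_PiM)
  then show "fst (h i) \<in> space E" "0 \<le> snd (h i)"
    by (auto simp: space_pair_measure space_restrict_space)
qed

lemma path_weight_measurable:
  assumes ws: "\<And>w. w \<in> set ws \<Longrightarrow> case_prod w \<in> borel_measurable (E \<Otimes>\<^sub>M \<nu>)"
    and n: "length ws \<le> n"
  shows "path_weight ws \<in> borel_measurable (history_space E n)"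
  unfolding path_weight_def[abs_def]
proof (rule borel_measurable_prod_ennreal)
  fix i assume i: "i \<in> {..<length ws}"
  have c: "(\<lambda>h. h j) \<in> history_space E n \<rightarrow>\<^sub>M E \<Otimes>\<^sub>M borel_nonneg" if "j \<le> n" for j
    unfolding history_space_def using that by (intro measurable_component_singleton) auto
  have [measurable]: "(\<lambda>h. fst (h j)) \<in> history_space E n \<rightarrow>\<^sub>M E" if "j \<le> n" for j
    by (rule measurable_compose[OF c[OF that]]) measurable
  have s [measurable]: "(\<lambda>h. snd (h j)) \<in> borel_measurable (history_space E n)" if "j \<le> n" for j
  proof (rule measurable_compose[OF c[OF that]])
    have "(\<lambda>x. x) \<in> borel_nonneg \<rightarrow>\<^sub>M borel" by (rule measurable_restrict_space1) simp
    then show "snd \<in> borel_measurable (E \<Otimes>\<^sub>M borel_nonneg)"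
      by (rule measurable_compose[OF measurable_snd])
  qed
  have le: "i \<le> n" "Suc i \<le> n" using i n by auto
  have [measurable]: "(\<lambda>h. max 0 (snd (h (Suc i)) - snd (h i))) \<in> history_space E n \<rightarrow>\<^sub>M borel_nonneg"
    using le by (intro measurable_restrict_space2) auto
  have h: "(\<lambda>h. (fst (h i), fst (h (Suc i)), max 0 (snd (h (Suc i)) - snd (h i))))
      \<in> history_space E n \<rightarrow>\<^sub>M E \<Otimes>\<^sub>M \<nu>"
    using le by measurable
  have "case_prod (ws ! i) \<in> borel_measurable (E \<Otimes>\<^sub>M \<nu>)"
    using ws i by auto
  from measurable_compose[OF h this] show "(\<lambda>h. (ws ! i) (fst (h i)) (fst (h (Suc i)), max 0 (snd (h (Suc i)) - snd (h i))))
      \<in> borel_measurable (history_space E n)"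
    by simp
qed

text \<open>Along realised paths the jump times are nondecreasing, so the truncation in
  \<open>path_weight\<close> has no effect. The last factor is split off because the conditional law
  given the history describes the last transition.\<close>

lemma path_weight_history_snoc:
  assumes mrp: "markov_renewal_process E \<nu> q M J S" and \<omega>: "\<omega> \<in> space M"
  shows "path_weight (ws @ [w]) (history J S (Suc (length ws)) \<omega>)
    = path_weight ws (history J S (length ws) \<omega>)
      * w (J (length ws) \<omega>) (J (Suc (length ws)) \<omega>, sojourn S (Suc (length ws)) \<omega>)"
proof -
  have "0 \<le> S (Suc i) \<omega> - S i \<omega>" for i
    using mrp \<omega> by (simp add: markov_renewal_process_def)
  then have "max 0 (S (Suc i) \<omega> - S i \<omega>) = S (Suc i) \<omega> - S i \<omega>" for i
    by (simp add: max_absorb2)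
  moreover have "(\<Prod>i<length ws. ((ws @ [w]) ! i) (fst (history J S (Suc (length ws)) \<omega> i))
        (fst (history J S (Suc (length ws)) \<omega> (Suc i)),
         max 0 (snd (history J S (Suc (length ws)) \<omega> (Suc i)) - snd (history J S (Suc (length ws)) \<omega> i))))
      = path_weight ws (history J S (length ws) \<omega>)"
    unfolding path_weight_def by (intro prod.cong) (simp_all add: history_def nth_append)
  ultimately show ?thesis
    unfolding path_weight_def[of "ws @ [w]"] by (simp add: history_def sojourn_def)
qed

text \<open>The first pair is drawn from the kernel started in \<open>\<rho>\<close>, so
  \<open>J 0\<close> is distributed as the state after one transition from \<open>\<rho>\<close>.
  Stationarity identifies this law with \<open>\<rho>\<close>.\<close>

lemma nn_integral_initial_state:
  assumes q: "semi_markov_density E \<nu> q" and mrp: "markov_renewal_process E \<nu> q M J S"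
    and s: "sets \<rho> = sets E" and st: "\<rho> \<bind> emc_kernel E \<nu> q = \<rho>"
    and init: "distr M (E \<Otimes>\<^sub>M borel_nonneg) (\<lambda>\<omega>. (J 0 \<omega>, sojourn S 0 \<omega>)) = \<rho> \<bind> smk \<nu> q"
    and F [measurable]: "F \<in> borel_measurable E"
  shows "(\<integral>\<^sup>+ \<omega>. F (J 0 \<omega>) \<partial>M) = (\<integral>\<^sup>+ x. F x \<partial>\<rho>)"
proof -
  have [measurable]: "J 0 \<in> M \<rightarrow>\<^sub>M E" "S 0 \<in> M \<rightarrow>\<^sub>M borel_nonneg"
    using mrp by (auto simp: markov_renewal_process_def)
  have m: "(\<lambda>\<omega>. (J 0 \<omega>, sojourn S 0 \<omega>)) \<in> M \<rightarrow>\<^sub>M E \<Otimes>\<^sub>M borel_nonneg"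
    unfolding sojourn_def by simp
  have K: "smk \<nu> q \<in> \<rho> \<rightarrow>\<^sub>M subprob_algebra (E \<Otimes>\<^sub>M borel_nonneg)"
    using measurable_prob_algebraD[OF smk_measurable[OF q]]
    by (simp cong: measurable_cong_sets[OF s])
  have Ff: "(\<lambda>z. F (fst z)) \<in> borel_measurable (E \<Otimes>\<^sub>M borel_nonneg)"
    by measurable
  have "(\<integral>\<^sup>+ \<omega>. F (J 0 \<omega>) \<partial>M) = (\<integral>\<^sup>+ z. F (fst z) \<partial>(\<rho> \<bind> smk \<nu> q))"
    unfolding init[symmetric] using Ff by (subst nn_integral_distr[OF m]) simp_all
  also have "\<dots> = (\<integral>\<^sup>+ x. \<integral>\<^sup>+ z. F (fst z) \<partial>smk \<nu> q x \<partial>\<rho>)"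
    by (rule nn_integral_bind[OF Ff K])
  also have "\<dots> = (\<integral>\<^sup>+ x. (tilt \<nu> q untilted ^^ 1) F x \<partial>\<rho>)"
    using sets_eq_imp_space_eq[OF s]
    by (intro nn_integral_cong) (simp add: nn_integral_smk[OF q] tilt_def)
  also have "\<dots> = (\<integral>\<^sup>+ x. F x \<partial>\<rho>)"
    by (rule stationary_nn_integral_pow[OF q s st F])
  finally show ?thesis .
qed

text \<open>Integrating out the last transition given the history replaces \<open>F\<close> by its
  image under the last tilted operator. The induction thus runs from the end of the list and needs
  an arbitrary terminal function \<open>F\<close>.\<close>

lemma nn_integral_path_weight:
  assumes q: "semi_markov_density E \<nu> q" and mrp: "markov_renewal_process E \<nu> q M J S"
    and s: "sets \<rho> = sets E" and st: "\<rho> \<bind> emc_kernel E \<nu> q = \<rho>"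
    and init: "distr M (E \<Otimes>\<^sub>M borel_nonneg) (\<lambda>\<omega>. (J 0 \<omega>, sojourn S 0 \<omega>)) = \<rho> \<bind> smk \<nu> q"
    and ws: "\<And>w. w \<in> set ws \<Longrightarrow> case_prod w \<in> borel_measurable (E \<Otimes>\<^sub>M \<nu>)"
    and F: "F \<in> borel_measurable E"
  shows "(\<integral>\<^sup>+ \<omega>. path_weight ws (history J S (length ws) \<omega>) * F (J (length ws) \<omega>) \<partial>M)
    = (\<integral>\<^sup>+ x. foldr (tilt \<nu> q) ws F x \<partial>\<rho>)"
  using ws F
proof (induction ws arbitrary: F rule: rev_induct)
  case Nil
  then show ?case
    using nn_integral_initial_state[OF q mrp s st init] by (simp add: path_weight_def)
next
  case (snoc w ws)
  let ?n = "length ws"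
  let ?f = "\<lambda>(h, z). path_weight ws h * (w (fst (h ?n)) z * F (fst z))"
  have w: "case_prod w \<in> borel_measurable (E \<Otimes>\<^sub>M \<nu>)" using snoc.prems by simp
  note F = snoc.prems(2)
  have J: "J i \<in> M \<rightarrow>\<^sub>M E" for i
    using mrp by (auto simp: markov_renewal_process_def)
  have pw [measurable]: "path_weight ws \<in> borel_measurable (history_space E ?n)"
    using snoc.prems by (intro path_weight_measurable) auto
  have "(\<lambda>h. h ?n) \<in> history_space E ?n \<rightarrow>\<^sub>M E \<Otimes>\<^sub>M borel_nonneg"
    unfolding history_space_def by (intro measurable_component_singleton) auto
  then have [measurable]: "(\<lambda>h. fst (h ?n)) \<in> history_space E ?n \<rightarrow>\<^sub>M E"
    by (rule measurable_compose) measurable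
  have f: "?f \<in> borel_measurable (history_space E ?n \<Otimes>\<^sub>M (E \<Otimes>\<^sub>M borel_nonneg))"
    using w F by measurable
  have "(\<integral>\<^sup>+ \<omega>. path_weight (ws @ [w]) (history J S (length (ws @ [w])) \<omega>) * F (J (length (ws @ [w])) \<omega>) \<partial>M)
      = (\<integral>\<^sup>+ \<omega>. ?f (history J S ?n \<omega>, J (Suc ?n) \<omega>, sojourn S (Suc ?n) \<omega>) \<partial>M)"
    using path_weight_history_snoc[OF mrp, of _ ws w]
    by (intro nn_integral_cong) (simp add: history_def mult.assoc)
  also have "\<dots> = (\<integral>\<^sup>+ \<omega>. \<integral>\<^sup>+ z. ?f (history J S ?n \<omega>, z) \<partial>smk \<nu> q (J ?n \<omega>) \<partial>M)"
    by (rule nn_integral_markov_renewal_transition[OF q mrp f])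
  also have "\<dots> = (\<integral>\<^sup>+ \<omega>. path_weight ws (history J S ?n \<omega>) * tilt \<nu> q w F (J ?n \<omega>) \<partial>M)"
  proof (rule nn_integral_cong)
    fix \<omega> assume "\<omega> \<in> space M"
    then have x: "J ?n \<omega> \<in> space E" using measurable_space[OF J] by auto
    note [measurable] = section_measurable[OF w x] F density_section_measurable[OF q x]
    show "(\<integral>\<^sup>+ z. ?f (history J S ?n \<omega>, z) \<partial>smk \<nu> q (J ?n \<omega>))
        = path_weight ws (history J S ?n \<omega>) * tilt \<nu> q w F (J ?n \<omega>)"
      unfolding tilt_def
      by (subst nn_integral_cmult[symmetric], measurable)
         (subst nn_integral_smk[OF q x], auto simp: history_def mult_ac)
  qed
  also have "\<dots> = (\<integral>\<^sup>+ x. foldr (tilt \<nu> q) ws (tilt \<nu> q w F) x \<partial>\<rho>)"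
    using snoc.prems w F by (intro snoc.IH tilt_measurable[OF q]) auto
  finally show ?case by simp
qed

text \<open>Here \<open>p\<close> is the true density, \<open>b\<close> the hypothesis near it and
  \<open>a\<close> the one far from \<open>b\<close>. Separation of \<open>a\<close> and
  \<open>b\<close> at \<open>\<nu>s\<close> gives the gain, proximity of \<open>p\<close> and
  \<open>b\<close> at \<open>\<eta>s\<close> limits the excess. The same bound serves both errors of
  the test.\<close>

lemma nn_integral_path_block_weights_le:
  fixes \<epsilon> :: real
  assumes dens: "semi_markov_density E \<nu> p" "semi_markov_density E \<nu> a" "semi_markov_density E \<nu> b"
    and mrp: "markov_renewal_process E \<nu> p M J S"
    and s: "sets \<rho> = sets E" and pr: "prob_space \<rho>" and st: "\<rho> \<bind> emc_kernel E \<nu> p = \<rho>"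
    and init: "distr M (E \<Otimes>\<^sub>M borel_nonneg) (\<lambda>\<omega>. (J 0 \<omega>, sojourn S 0 \<omega>)) = \<rho> \<bind> smk \<nu> p"
    and k: "0 < k"
    and sets: "sets \<nu>s = sets E" "sets \<eta>s = sets E"
    and lower: "\<And>x B. x \<in> space E \<Longrightarrow> B \<in> sets E \<Longrightarrow>
      emeasure \<nu>s B \<le> (1 / of_nat k) * (\<Sum>u=1..k. emeasure (emc_kernel_n E \<nu> p u x) B)"
    and upper: "\<And>x B. x \<in> space E \<Longrightarrow> B \<in> sets E \<Longrightarrow>
      emeasure (emc_kernel_n E \<nu> p l x) B \<le> emeasure \<eta>s B"
    and eps: "0 < \<epsilon>"
    and far: "ennreal \<epsilon> < smk_dist \<nu> \<nu>s a b"
    and close: "smk_dist \<nu> \<eta>s p b < ennreal (\<epsilon> * (1 / (16 * 2 ^ k)))"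
    and n: "n = Suc (m * (l + Suc k) + r)"
  shows "(\<integral>\<^sup>+ h. path_weight
      (block_weights (\<lambda>x z. ennreal (hellinger_weight (a x z) (b x z))) l k m r) h
      \<partial>history_law E M J S n) \<le> ennreal (exp (- (\<epsilon>\<^sup>2 / (12 * 2 ^ k)))) ^ Suc m"
proof -
  interpret \<rho>: prob_space \<rho> by (rule pr)
  let ?P = "tilt \<nu> p untilted"
  define w where "w = (\<lambda>x z. ennreal (hellinger_weight (a x z) (b x z)))"
  define d where "d = (\<lambda>x. ennreal (1 / 6) * hellinger_sq \<nu> a b x)"
  define e where "e = (\<lambda>x. 8 * hellinger_sq \<nu> p b x)"
  \<comment> \<open>\<open>s'\<close> is the gain and \<open>t\<close> the largest excess of one
    block: the first is \<open>2 ^ k\<close> below \<open>\<epsilon>\<^sup>2 / 6\<close>, the second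
    is \<open>2 ^ Suc k\<close> times the bound on \<open>?R\<close> proved below.\<close>
  define s' t where "s' = \<epsilon>\<^sup>2 / (6 * 2 ^ k)" and "t = \<epsilon>\<^sup>2 / (16 * 2 ^ k)"
  let ?D = "\<integral>\<^sup>+ x. d x \<partial>\<nu>s" and ?R = "\<integral>\<^sup>+ x. e x \<partial>\<eta>s"
  have sp: "space \<rho> = space E" by (rule sets_eq_imp_space_eq[OF s])
  have w: "case_prod w \<in> borel_measurable (E \<Otimes>\<^sub>M \<nu>)"
    unfolding w_def by (rule hellinger_weight_density_measurable[OF dens(2,3)])
  have w_ge: "1 \<le> 2 * w x z" and w_le: "w x z \<le> 2" if "x \<in> space E" "z \<in> space \<nu>" for x z
  proof -
    have nn: "0 \<le> a x z" "0 \<le> b x z"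
      using dens that by (auto intro: density_nonneg)
    have "ennreal 1 \<le> ennreal (2 * hellinger_weight (a x z) (b x z))"
      using hellinger_weight_bounds(1)[OF nn] by (intro ennreal_leI) simp
    then show "1 \<le> 2 * w x z"
      using hellinger_weight_bounds(1)[OF nn] by (simp add: w_def ennreal_mult)
    show "w x z \<le> 2"
      using ennreal_leI[OF hellinger_weight_bounds(2)[OF nn]] by (simp add: w_def)
  qed
  have hm: "hellinger_sq \<nu> a b \<in> borel_measurable E" "hellinger_sq \<nu> p b \<in> borel_measurable E"
    using dens by (auto intro: hellinger_sq_measurable)
  then have d: "d \<in> borel_measurable E" and e: "e \<in> borel_measurable E"
    by (auto simp: d_def e_def)
  have le: "tilt \<nu> p w (\<lambda>_. 1) x + d x \<le> 1 + e x" if "x \<in> space E" for x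
    unfolding w_def d_def e_def by (rule tilt_hellinger_weight_le[OF dens that])
  have avg: "?D \<le> (1 / of_nat k) * (\<Sum>u=1..k. (?P ^^ u) d x)" if "x \<in> space E" for x
    using lower that by (intro nn_integral_le_avg_tilt[OF dens(1) that k sets(1) _ d]) auto
  have R: "(?P ^^ l) e x \<le> ?R" if "x \<in> space E" for x
    using upper that by (intro tilt_pow_le_nn_integral[OF dens(1) that sets(2) _ e]) auto
  have k1: "1 / (of_nat k :: ennreal) = ennreal (1 / real k)"
    using k divide_ennreal[of 1 "real k"] by (simp add: ennreal_of_nat_eq_real_of_nat)
  \<comment> \<open>The block estimate takes the sum, which dominates the average; the sharper
    \<open>avg\<close> is kept for the stationary estimate of the leading factor.\<close>
  have D_sum: "?D \<le> (\<Sum>u=1..k. (?P ^^ u) d x)" if "x \<in> space E" for x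
  proof -
    have "ennreal (1 / real k) \<le> ennreal 1" using k by (intro ennreal_leI) simp
    then have "(1 / of_nat k) * (\<Sum>u=1..k. (?P ^^ u) d x) \<le> 1 * (\<Sum>u=1..k. (?P ^^ u) d x)"
      unfolding k1 by (intro mult_right_mono) auto
    then show ?thesis using avg[OF that] by simp
  qed
  have D_ge: "ennreal (\<epsilon>\<^sup>2 / 6) \<le> ?D"
  proof -
    have "ennreal (\<epsilon>\<^sup>2) \<le> (\<integral>\<^sup>+ x. hellinger_sq \<nu> a b x \<partial>\<nu>s)"
      using far eps unfolding smk_dist_def by (intro ennreal_less_ennsqrt) auto
    then have "ennreal (1 / 6) * ennreal (\<epsilon>\<^sup>2) \<le> ennreal (1 / 6) * (\<integral>\<^sup>+ x. hellinger_sq \<nu> a b x \<partial>\<nu>s)"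
      by (intro mult_left_mono) auto
    also have "\<dots> = ?D"
      unfolding d_def using hm by (intro nn_integral_cmult[symmetric]) (simp cong: measurable_cong_sets[OF sets(1)])
    finally show ?thesis by (simp add: ennreal_mult[symmetric])
  qed
  have R_le: "?R \<le> ennreal (\<epsilon>\<^sup>2 / (32 * (2 ^ k)\<^sup>2))"
  proof -
    have "?R = 8 * (\<integral>\<^sup>+ x. hellinger_sq \<nu> p b x \<partial>\<eta>s)"
      unfolding e_def using hm by (intro nn_integral_cmult) (simp cong: measurable_cong_sets[OF sets(2)])
    also have "\<dots> \<le> 8 * ennreal ((\<epsilon> * (1 / (16 * 2 ^ k)))\<^sup>2)"
      using close eps unfolding smk_dist_def
      by (intro mult_left_mono ennsqrt_less_ennreal) auto
    also have "\<dots> = ennreal (8 * (\<epsilon> * (1 / (16 * 2 ^ k)))\<^sup>2)"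
      by (simp add: ennreal_mult)
    also have "8 * (\<epsilon> * (1 / (16 * 2 ^ k)))\<^sup>2 = \<epsilon>\<^sup>2 / (32 * (2 ^ k)\<^sup>2)"
      by (simp add: power_mult_distrib power_divide)
    finally show ?thesis .
  qed
  have st_nonneg: "0 \<le> s'" "0 \<le> t" by (auto simp: s'_def t_def)
  \<comment> \<open>The net gain is \<open>1 / 6 - 1 / 16 = 5 / 48\<close> in units of
    \<open>\<epsilon>\<^sup>2 / 2 ^ k\<close>, which exceeds \<open>1 / 12\<close>.\<close>
  have exp_le: "ennreal (exp (t - s')) \<le> ennreal (exp (- (\<epsilon>\<^sup>2 / (12 * 2 ^ k))))"
    unfolding s'_def t_def by (intro ennreal_leI) (simp add: field_simps)
  have block: "(?P ^^ l) ((tilt \<nu> p w ^^ Suc k) (\<lambda>_. 1)) x \<le> ennreal (exp (- (\<epsilon>\<^sup>2 / (12 * 2 ^ k))))"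
    if x: "x \<in> space E" for x
  proof -
    have "(?P ^^ l) ((tilt \<nu> p w ^^ Suc k) (\<lambda>_. 1)) x + ennreal s'
        \<le> (?P ^^ l) ((tilt \<nu> p w ^^ Suc k) (\<lambda>_. 1)) x + ennreal ((1 / 2) ^ k) * ?D"
    proof (rule add_left_mono)
      have "ennreal s' = ennreal ((1 / 2) ^ k) * ennreal (\<epsilon>\<^sup>2 / 6)"
        by (simp add: s'_def ennreal_mult[symmetric] power_divide)
      also have "\<dots> \<le> ennreal ((1 / 2) ^ k) * ?D"
        using D_ge by (intro mult_left_mono) auto
      finally show "ennreal s' \<le> ennreal ((1 / 2) ^ k) * ?D" .
    qed
    also have "\<dots> \<le> 1 + 2 ^ Suc k * ?R"
      using w_ge w_le le D_sum R by (intro tilt_block_le[OF dens(1) w _ _ d e _ _ _ x]) auto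
    also have "\<dots> \<le> 1 + ennreal t"
    proof (rule add_left_mono)
      have "2 ^ Suc k * ?R \<le> 2 ^ Suc k * ennreal (\<epsilon>\<^sup>2 / (32 * (2 ^ k)\<^sup>2))"
        by (intro mult_left_mono R_le) auto
      also have "\<dots> = ennreal (2 ^ Suc k * (\<epsilon>\<^sup>2 / (32 * (2 ^ k)\<^sup>2)))"
      proof -
        have "(2 :: ennreal) ^ Suc k = ennreal (2 ^ Suc k)"
          using ennreal_power[of 2 "Suc k"] by (simp del: power_Suc)
        then show ?thesis by (simp only: ennreal_mult[symmetric] zero_le_power2 zero_le_power
              zero_le_divide_iff) (simp add: ennreal_mult[symmetric] del: power_Suc)
      qed
      also have "2 ^ Suc k * (\<epsilon>\<^sup>2 / (32 * (2 ^ k)\<^sup>2)) = t"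
        by (simp add: t_def power2_eq_square)
      finally show "2 ^ Suc k * ?R \<le> ennreal t" .
    qed
    finally show ?thesis
      by (rule order_trans[OF ennreal_add_le_imp_le_exp[OF _ st_nonneg] exp_le])
  qed
  \<comment> \<open>Under \<open>\<rho>\<close> every untilted iterate of a function has the same
    integral. Hence the average over \<open>k\<close> steps collapses to the integral of
    \<open>d\<close>, and the majorisation after \<open>l\<close> steps bounds the integral of
    \<open>e\<close> directly. No power of \<open>2\<close> is lost, and the result is weakened to
    the same \<open>s'\<close> and \<open>t\<close> as for a block.\<close>
  have first: "(\<integral>\<^sup>+ x. tilt \<nu> p w (\<lambda>_. 1) x \<partial>\<rho>) \<le> ennreal (exp (- (\<epsilon>\<^sup>2 / (12 * 2 ^ k))))"
  proof -
    note mr = measurable_cong_sets[OF s]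
    have mP: "(?P ^^ u) F \<in> borel_measurable \<rho>" if "F \<in> borel_measurable E" for u F
      using tilts_measurable[OF dens(1), of "replicate u untilted" F] that
      by (simp add: foldr_replicate cong: mr)
    have "?D = (\<integral>\<^sup>+ x. ?D \<partial>\<rho>)" by (simp add: \<rho>.emeasure_space_1)
    also have "\<dots> \<le> (\<integral>\<^sup>+ x. (1 / of_nat k) * (\<Sum>u=1..k. (?P ^^ u) d x) \<partial>\<rho>)"
      using avg sp by (intro nn_integral_mono) auto
    also have "\<dots> = (1 / of_nat k) * (\<Sum>u=1..k. \<integral>\<^sup>+ x. (?P ^^ u) d x \<partial>\<rho>)"
      using mP[OF d] by (subst nn_integral_cmult) (auto simp: nn_integral_sum)
    also have "\<dots> = (1 / of_nat k) * (of_nat k * (\<integral>\<^sup>+ x. d x \<partial>\<rho>))"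
      by (simp add: stationary_nn_integral_pow[OF dens(1) s st d])
    also have "\<dots> = (\<integral>\<^sup>+ x. d x \<partial>\<rho>)"
    proof -
      have "ennreal (1 / real k) * ennreal (real k) = 1"
        using k by (simp add: ennreal_mult[symmetric])
      then show ?thesis
        unfolding k1 unfolding ennreal_of_nat_eq_real_of_nat by (simp add: mult.assoc[symmetric])
    qed
    finally have D\<rho>: "?D \<le> (\<integral>\<^sup>+ x. d x \<partial>\<rho>)" .
    have "(\<integral>\<^sup>+ x. e x \<partial>\<rho>) = (\<integral>\<^sup>+ x. (?P ^^ l) e x \<partial>\<rho>)"
      by (rule stationary_nn_integral_pow[OF dens(1) s st e, symmetric])
    also have "\<dots> \<le> (\<integral>\<^sup>+ x. ?R \<partial>\<rho>)"
      using R sp by (intro nn_integral_mono) auto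
    finally have R\<rho>: "(\<integral>\<^sup>+ x. e x \<partial>\<rho>) \<le> ?R" by (simp add: \<rho>.emeasure_space_1)
    have [measurable]: "tilt \<nu> p w (\<lambda>_. 1) \<in> borel_measurable \<rho>" "d \<in> borel_measurable \<rho>" "e \<in> borel_measurable \<rho>"
      using tilt_measurable[OF dens(1) w, of "\<lambda>_. 1"] d e by (simp_all cong: mr)
    have one_le: "(1::real) \<le> 2 ^ k" by simp
    have "(\<integral>\<^sup>+ x. tilt \<nu> p w (\<lambda>_. 1) x \<partial>\<rho>) + ennreal s' \<le> (\<integral>\<^sup>+ x. tilt \<nu> p w (\<lambda>_. 1) x \<partial>\<rho>) + (\<integral>\<^sup>+ x. d x \<partial>\<rho>)"
    proof (rule add_left_mono)
      have "s' \<le> \<epsilon>\<^sup>2 / 6"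
        unfolding s'_def using one_le by (intro divide_left_mono) auto
      then show "ennreal s' \<le> (\<integral>\<^sup>+ x. d x \<partial>\<rho>)"
        by (rule order_trans[OF ennreal_leI order_trans[OF D_ge D\<rho>]])
    qed
    also have "\<dots> = (\<integral>\<^sup>+ x. tilt \<nu> p w (\<lambda>_. 1) x + d x \<partial>\<rho>)"
      by (rule nn_integral_add[symmetric]) measurable
    also have "\<dots> \<le> (\<integral>\<^sup>+ x. 1 + e x \<partial>\<rho>)"
      using le sp by (intro nn_integral_mono) auto
    also have "\<dots> = 1 + (\<integral>\<^sup>+ x. e x \<partial>\<rho>)"
      by (subst nn_integral_add) (auto simp: \<rho>.emeasure_space_1)
    also have "\<dots> \<le> 1 + ennreal t"
    proof (rule add_left_mono)
      have "\<epsilon>\<^sup>2 / (32 * (2 ^ k)\<^sup>2) \<le> t"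
        unfolding t_def
      proof (rule divide_left_mono)
        show "16 * 2 ^ k \<le> 32 * (2 ^ k :: real)\<^sup>2"
          by (simp add: power2_eq_square) (use one_le in linarith)
      qed auto
      then show "(\<integral>\<^sup>+ x. e x \<partial>\<rho>) \<le> ennreal t"
        by (rule order_trans[OF order_trans[OF R\<rho> R_le] ennreal_leI])
    qed
    finally show ?thesis
      by (rule order_trans[OF ennreal_add_le_imp_le_exp[OF _ st_nonneg] exp_le])
  qed
  let ?ws = "block_weights w l k m r"
  have ws: "case_prod v \<in> borel_measurable (E \<Otimes>\<^sub>M \<nu>)" if "v \<in> set ?ws" for v
    using that set_block_weights[of w l k m r] w by auto
  have len: "length ?ws = n" by (simp only: length_block_weights n)
  have "(\<integral>\<^sup>+ h. path_weight ?ws h \<partial>history_law E M J S n)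
      = (\<integral>\<^sup>+ \<omega>. path_weight ?ws (history J S n \<omega>) \<partial>M)"
    unfolding history_law_def
    using path_weight_measurable[OF ws, where n = n] len
    by (intro nn_integral_distr[OF history_measurable[OF mrp]]) simp_all
  also have "\<dots> = (\<integral>\<^sup>+ x. foldr (tilt \<nu> p) ?ws (\<lambda>_. 1) x \<partial>\<rho>)"
    using nn_integral_path_weight[OF dens(1) mrp s st init ws, where ws = ?ws and F = "\<lambda>_. 1"]
    by (simp add: len)
  also have "\<dots> \<le> ennreal (exp (- (\<epsilon>\<^sup>2 / (12 * 2 ^ k)))) ^ Suc m"
    by (rule nn_integral_block_weights_le[OF dens(1) w block s first])
  finally show ?thesis by (simp only: w_def)
qed

text \<open>Both products have the same pattern of tilted and neutral positions, so they can be
  paired factor by factor. This holds for every history in the space, since the truncation keeps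
  each increment in the domain of the densities.\<close>

lemma path_block_weights_swap:
  assumes dens: "semi_markov_density E \<nu> a" "semi_markov_density E \<nu> b"
    and n: "n = Suc (m * (l + Suc k) + r)" and h: "h \<in> space (history_space E n)"
  shows "path_weight (block_weights (\<lambda>x z. ennreal (hellinger_weight (a x z) (b x z))) l k m r) h
    * path_weight (block_weights (\<lambda>x z. ennreal (hellinger_weight (b x z) (a x z))) l k m r) h = 1"
proof -
  let ?w = "\<lambda>a b x z. ennreal (hellinger_weight (a x z) (b x z))"
  let ?b = "\<lambda>a b. block_weights (?w a b) l k m r"
  have len: "length (?b a b) = n" for a b :: "'a smk_density"
    by (simp only: length_block_weights n)
  \<comment> \<open>The pattern is encoded once as a list of Booleans, with \<open>True\<close> at
    the tilted positions; the two weight lists are images of it.\<close>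
  define g where "g c = (if c then ?w a b else untilted)" for c
  define g' where "g' c = (if c then ?w b a else untilted)" for c
  define cs where "cs = True # concat (replicate m (replicate l False @ replicate (Suc k) True))
      @ replicate r False"
  have maps: "?b a b = map g cs" "?b b a = map g' cs"
    by (simp_all add: block_weights_def cs_def g_def g'_def map_concat)
  have "g c x z * g' c x z = 1" if "x \<in> space E" "z \<in> space \<nu>" for c x z
  proof -
    have nn: "0 \<le> a x z" "0 \<le> b x z"
      using dens that by (auto intro: density_nonneg)
    have "0 \<le> hellinger_weight (a x z) (b x z)" "0 \<le> hellinger_weight (b x z) (a x z)"
      using hellinger_weight_bounds(1)[of "a x z" "b x z"] hellinger_weight_bounds(1)[of "b x z" "a x z"] nn
      by linarith+
    then show ?thesis
      using hellinger_weight_mult_swap[OF nn] by (simp add: g_def g'_def ennreal_mult[symmetric])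
  qed
  note swap = this
  have lc: "length cs = n" using len[of a b] maps by simp
  show ?thesis
    unfolding maps path_weight_def prod.distrib[symmetric] length_map
  proof (rule prod.neutral, intro ballI)
    fix i assume i: "i \<in> {..<length cs}"
    then have "i \<le> n" "Suc i \<le> n" using lc by auto
    then show "(map g cs ! i) (fst (h i)) (fst (h (Suc i)), max 0 (snd (h (Suc i)) - snd (h i)))
        * (map g' cs ! i) (fst (h i)) (fst (h (Suc i)), max 0 (snd (h (Suc i)) - snd (h i))) = 1"
      using i history_space_component[OF h] by (auto simp: space_nu intro!: swap)
  qed
qed

end

section \<open>The test\<close>

lemma integral_le_of_nn_integral_le:
  fixes f :: "'b \<Rightarrow> real"
  assumes "f \<in> borel_measurable M" "\<And>x. x \<in> space M \<Longrightarrow> 0 \<le> f x"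
    and "\<And>x. x \<in> space M \<Longrightarrow> ennreal (f x) \<le> g x"
    and "(\<integral>\<^sup>+ x. g x \<partial>M) \<le> ennreal c" "0 \<le> c"
  shows "(\<integral>x. f x \<partial>M) \<le> c"
proof -
  have "(\<integral>\<^sup>+ x. ennreal (f x) \<partial>M) \<le> (\<integral>\<^sup>+ x. g x \<partial>M)"
    using assms(3) by (intro nn_integral_mono)
  then have "(\<integral>\<^sup>+ x. ennreal (f x) \<partial>M) \<le> ennreal c"
    using assms(4) by (rule order_trans)
  then show ?thesis
    using assms by (subst integral_eq_nn_integral) (auto intro!: enn2real_leI)
qed

theorem proposition2:
  fixes E :: "'a measure"
    and \<nu> :: "('a \<times> real) measure"
    and \<Q> :: "'a smk_density set"
    and \<rho> :: "'a smk_density \<Rightarrow> 'a measure"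
    and \<Omega> :: "'w measure"
    and P :: "'a smk_density \<Rightarrow> 'w measure"
    and J :: "nat \<Rightarrow> 'w \<Rightarrow> 'a"
    and S :: "nat \<Rightarrow> 'w \<Rightarrow> real"
    and \<nu>s \<eta>s :: "'a measure"
    and k l :: nat
  assumes model: "semi_markov_model E \<nu> \<Q> \<rho> \<Omega> P J S"
    and sets_nus: "sets \<nu>s = sets E"
    and sets_etas: "sets \<eta>s = sets E"
    and k_pos: "0 < k"
    and l_pos: "0 < l"
    and lower: "\<And>q x B. q \<in> \<Q> \<Longrightarrow> x \<in> space E \<Longrightarrow> B \<in> sets E \<Longrightarrow>
      (1 / of_nat k) * (\<Sum>u=1..k. emeasure (emc_kernel_n E \<nu> q u x) B) \<ge> emeasure \<nu>s B"
    and upper: "\<And>q x B. q \<in> \<Q> \<Longrightarrow> x \<in> space E \<Longrightarrow> B \<in> sets E \<Longrightarrow>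
      emeasure (emc_kernel_n E \<nu> q l x) B \<le> emeasure \<eta>s B"
  shows "\<exists>\<xi> K K' :: real. 0 < \<xi> \<and> \<xi> < 1 \<and> 0 < K \<and> 0 < K' \<and>
    (\<forall>n::nat. \<forall>\<Q>n q0 q1. \<forall>\<epsilon>::real.
       1 \<le> n \<longrightarrow> \<Q>n \<subseteq> \<Q> \<longrightarrow> q0 \<in> \<Q> \<longrightarrow> 0 < \<epsilon> \<longrightarrow> q1 \<in> \<Q>n \<longrightarrow>
       ennreal \<epsilon> < smk_dist \<nu> \<nu>s q1 q0 \<longrightarrow>
       (\<exists>\<psi>. is_test E n \<psi> \<and>
          (\<integral>h. \<psi> h \<partial>history_law E (P q0) J S n) \<le> exp (- K * real n * \<epsilon>\<^sup>2) \<and>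
          (SUP q\<in>{q \<in> \<Q>n. smk_dist \<nu> \<eta>s q1 q < ennreal (\<epsilon> * \<xi>)}.
             \<integral>h. (1 - \<psi> h) \<partial>history_law E (P q) J S n) \<le> exp (- K' * real n * \<epsilon>\<^sup>2)))"
proof -
  interpret semi_markov_model E \<nu> \<Q> \<rho> \<Omega> P J S by (rule model)
  interpret smk_space \<nu> E
    using sets_nu sigma_finite_nu by (simp add: smk_space_def smk_space_axioms_def)
  define N where "N = l + Suc k"
  \<comment> \<open>With this \<open>\<xi>\<close> the excess of a block,
    \<open>2 ^ Suc k * 8 * \<xi>\<^sup>2 = 1 / (16 * 2 ^ k)\<close> in units of
    \<open>\<epsilon>\<^sup>2\<close>, stays below the gain \<open>1 / (6 * 2 ^ k)\<close>. The rate
    \<open>K\<close> spreads the net exponent of a block over its \<open>N\<close>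
    transitions.\<close>
  define \<xi> K :: real where "\<xi> = 1 / (16 * 2 ^ k)" and "K = 1 / (12 * 2 ^ k * real N)"
  have N: "0 < N" by (simp add: N_def)
  have test: "\<exists>\<psi>. is_test E n \<psi> \<and>
      (\<integral>h. \<psi> h \<partial>history_law E (P q0) J S n) \<le> exp (- K * real n * \<epsilon>\<^sup>2) \<and>
      (SUP q\<in>{q \<in> \<Q>n. smk_dist \<nu> \<eta>s q1 q < ennreal (\<epsilon> * \<xi>)}.
         \<integral>h. (1 - \<psi> h) \<partial>history_law E (P q) J S n) \<le> exp (- K * real n * \<epsilon>\<^sup>2)"
    if n: "1 \<le> n" and sub: "\<Q>n \<subseteq> \<Q>" and q0: "q0 \<in> \<Q>" and eps: "0 < \<epsilon>" and q1: "q1 \<in> \<Q>n"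
      and far: "ennreal \<epsilon> < smk_dist \<nu> \<nu>s q1 q0"
    for n \<Q>n q0 q1 and \<epsilon> :: real
  proof -
    \<comment> \<open>One transition is reserved for the leading factor; the other
      \<open>n - 1\<close> form \<open>m\<close> full blocks and \<open>r\<close> neutral
      transitions.\<close>
    define m r where "m = (n - 1) div N" and "r = (n - 1) mod N"
    have n_eq: "n = Suc (m * (l + Suc k) + r)"
      using n unfolding m_def r_def N_def by (simp only: div_mult_mod_eq)
    have q1Q: "q1 \<in> \<Q>" using q1 sub by auto
    define W where "W = (\<lambda>a b. block_weights
      (\<lambda>x z. ennreal (hellinger_weight (a x z :: real) (b x z))) l k m r :: ('a \<Rightarrow> 'a \<times> real \<Rightarrow> ennreal) list)"
    let ?H = "history_space E n"
    have law: "sets (history_law E (P q) J S n) = sets ?H" "space (history_law E (P q) J S n) = space ?H" for q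
      by (simp_all add: history_law_def)
    \<comment> \<open>The remainder is shorter than a block, so \<open>n\<close> is at most
      \<open>Suc m * N\<close>. The leading factor counts as one more block, which covers the case
      \<open>m = 0\<close>.\<close>
    have rate: "exp (- (\<epsilon>\<^sup>2 / (12 * 2 ^ k))) ^ Suc m \<le> exp (- K * real n * \<epsilon>\<^sup>2)"
    proof -
      have "r < N" using N by (simp add: r_def)
      then have "n \<le> Suc m * N" using n_eq by (simp add: N_def)
      then have "real n \<le> real (Suc m) * real N" by (metis of_nat_le_iff of_nat_mult)
      then have "real n / real N \<le> real (Suc m)" using N by (simp add: divide_le_eq)
      then have "(\<epsilon>\<^sup>2 / (12 * 2 ^ k)) * (real n / real N) \<le> (\<epsilon>\<^sup>2 / (12 * 2 ^ k)) * real (Suc m)"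
        by (intro mult_left_mono) auto
      moreover have "K * real n * \<epsilon>\<^sup>2 = (\<epsilon>\<^sup>2 / (12 * 2 ^ k)) * (real n / real N)"
        by (simp add: K_def)
      moreover have "exp (- (\<epsilon>\<^sup>2 / (12 * 2 ^ k))) ^ Suc m = exp (real (Suc m) * - (\<epsilon>\<^sup>2 / (12 * 2 ^ k)))"
        by (rule exp_of_nat_mult[symmetric])
      ultimately show ?thesis by (simp add: mult.commute del: of_nat_Suc)
    qed
    have bound: "(\<integral>\<^sup>+ h. path_weight (W a b) h \<partial>history_law E (P q) J S n) \<le> ennreal (exp (- K * real n * \<epsilon>\<^sup>2))"
      if "q \<in> \<Q>" "a \<in> \<Q>" "b \<in> \<Q>" "ennreal \<epsilon> < smk_dist \<nu> \<nu>s a b" "smk_dist \<nu> \<eta>s q b < ennreal (\<epsilon> * \<xi>)"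
      for q a b
    proof -
      have erg: "prob_space (\<rho> q)" "sets (\<rho> q) = sets E" "\<rho> q \<bind> emc_kernel E \<nu> q = \<rho> q"
        using ergodic[OF \<open>q \<in> \<Q>\<close>] by (auto simp: ergodic_emc_def)
      have "(\<integral>\<^sup>+ h. path_weight (W a b) h \<partial>history_law E (P q) J S n)
          \<le> ennreal (exp (- (\<epsilon>\<^sup>2 / (12 * 2 ^ k)))) ^ Suc m"
        unfolding W_def
        by (rule nn_integral_path_block_weights_le[OF density density density process erg(2,1,3)
              initial_law k_pos sets_nus sets_etas lower upper eps _ _ n_eq])
           (use that in \<open>simp_all add: \<xi>_def\<close>)
      also have "\<dots> = ennreal (exp (- (\<epsilon>\<^sup>2 / (12 * 2 ^ k))) ^ Suc m)"
        by (rule ennreal_power) simp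
      also have "\<dots> \<le> ennreal (exp (- K * real n * \<epsilon>\<^sup>2))"
        by (rule ennreal_leI[OF rate])
      finally show ?thesis .
    qed
    \<comment> \<open>The test is nonrandomised, and the value \<open>1\<close> of the product leads
      to rejection.\<close>
    define \<psi> :: "(nat \<Rightarrow> 'a \<times> real) \<Rightarrow> real"
      where "\<psi> = indicator {h \<in> space ?H. 1 \<le> path_weight (W q1 q0) h}"
    have [measurable]: "path_weight (W q1 q0) \<in> borel_measurable ?H"
    proof (rule path_weight_measurable)
      show "length (W q1 q0) \<le> n" unfolding W_def length_block_weights n_eq by simp
      show "case_prod w \<in> borel_measurable (E \<Otimes>\<^sub>M \<nu>)" if "w \<in> set (W q1 q0)" for w
        using that set_block_weights hellinger_weight_density_measurable[OF density[OF q1Q] density[OF q0]]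
        unfolding W_def by fastforce
    qed
    have \<psi> [measurable]: "\<psi> \<in> borel_measurable ?H"
      unfolding \<psi>_def by measurable
    have \<psi>_bounds: "0 \<le> \<psi> h" "\<psi> h \<le> 1" for h
      by (auto simp: \<psi>_def indicator_def)
    have \<psi>_le: "ennreal (\<psi> h) \<le> path_weight (W q1 q0) h" for h
      by (auto simp: \<psi>_def indicator_def)
    \<comment> \<open>Where the test accepts, the product is below \<open>1\<close>, so its
      reciprocal, the product with \<open>q0\<close> and \<open>q1\<close> exchanged, is at least
      \<open>1\<close>.\<close>
    have not_\<psi>_le: "ennreal (1 - \<psi> h) \<le> path_weight (W q0 q1) h" if h: "h \<in> space ?H" for h
    proof (cases "1 \<le> path_weight (W q1 q0) h")
      case False
      have "1 = path_weight (W q1 q0) h * path_weight (W q0 q1) h"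
        unfolding W_def by (rule path_block_weights_swap[OF density[OF q1Q] density[OF q0] n_eq h, symmetric])
      also have "\<dots> \<le> 1 * path_weight (W q0 q1) h"
        using False by (intro mult_right_mono) auto
      finally show ?thesis using False by (simp add: \<psi>_def)
    qed (use h in \<open>simp add: \<psi>_def\<close>)
    \<comment> \<open>For the first error the true density is \<open>q0\<close> itself, so the
      proximity condition is met at distance \<open>0\<close>.\<close>
    have self: "smk_dist \<nu> \<eta>s q q < ennreal (\<epsilon> * \<xi>)" for q
      using eps by (simp add: smk_dist_self \<xi>_def)
    have "is_test E n \<psi>"
      using \<psi> \<psi>_bounds by (simp add: is_test_def)
    moreover have "(\<integral>h. \<psi> h \<partial>history_law E (P q0) J S n) \<le> exp (- K * real n * \<epsilon>\<^sup>2)"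
      using \<psi> \<psi>_bounds \<psi>_le bound[OF q0 q1Q q0 far self]
      by (intro integral_le_of_nn_integral_le[where g = "path_weight (W q1 q0)"])
         (auto simp: measurable_cong_sets[OF law(1)])
    moreover have "(SUP q\<in>{q \<in> \<Q>n. smk_dist \<nu> \<eta>s q1 q < ennreal (\<epsilon> * \<xi>)}.
         \<integral>h. (1 - \<psi> h) \<partial>history_law E (P q) J S n) \<le> exp (- K * real n * \<epsilon>\<^sup>2)"
    proof (rule cSUP_least)
      \<comment> \<open>A real supremum is bounded by its upper bounds only over a nonempty set;
        \<open>q1\<close> belongs to this one.\<close>
      show "{q \<in> \<Q>n. smk_dist \<nu> \<eta>s q1 q < ennreal (\<epsilon> * \<xi>)} \<noteq> {}"
        using q1 self by auto
      fix q assume "q \<in> {q \<in> \<Q>n. smk_dist \<nu> \<eta>s q1 q < ennreal (\<epsilon> * \<xi>)}"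
      then have q: "q \<in> \<Q>" and close: "smk_dist \<nu> \<eta>s q q1 < ennreal (\<epsilon> * \<xi>)"
        using sub by (auto simp: smk_dist_commute[of \<nu> \<eta>s q])
      \<comment> \<open>For the second error the roles are exchanged: \<open>q1\<close> is the
        nearby hypothesis and \<open>q0\<close> the distant one.\<close>
      have far': "ennreal \<epsilon> < smk_dist \<nu> \<nu>s q0 q1"
        using far by (simp add: smk_dist_commute[of \<nu> \<nu>s q0])
      show "(\<integral>h. (1 - \<psi> h) \<partial>history_law E (P q) J S n) \<le> exp (- K * real n * \<epsilon>\<^sup>2)"
        using \<psi> \<psi>_bounds not_\<psi>_le bound[OF q q0 q1Q far' close]
        by (intro integral_le_of_nn_integral_le[where g = "path_weight (W q0 q1)"])
           (auto simp: measurable_cong_sets[OF law(1)] law(2))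
    qed
    ultimately show ?thesis by blast
  qed
  have "0 < \<xi>" "0 < K" using N by (auto simp: \<xi>_def K_def)
  moreover have "\<xi> < 1"
  proof -
    have "(1::real) \<le> 2 ^ k" by simp
    then have "(1::real) < 16 * 2 ^ k" by linarith
    then show ?thesis by (simp add: \<xi>_def divide_less_eq)
  qed
  ultimately show ?thesis
    \<comment> \<open>Both exponential rates are witnessed by the same \<open>K\<close>.\<close>
    using test by (intro exI[of _ \<xi>] exI[of _ K] conjI allI impI)
qed

end
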